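(* Let $\ell\ge1$, $d=\ell(\ell+1)/2$, and $\lambda=(\lambda_1,\ldots,\lambda_{\ell+1})\in\mathbb{C}^{\ell+1}$ with $\mathrm{Re}(\lambda_i)>0$. For the special values of the spectral variables $$\gamma_{k,i}(\lambda)=\lambda_{k+1}\ (1\le i\le k\le\ell),\qquad \nu_{k,k}(\lambda)=\sum_{i=1}^k\lambda_i\ (1\le k\le\ell),\qquad \nu_{k,i}(\lambda)=0\ (1\le i<k\le\ell),$$ the restricted GG-hypergeometric function ${}^{\rm res}\Phi^{\mathfrak{gl}_{\ell+1}}_{\gamma,\nu}$ is expressed through the $\mathfrak{gl}_{\ell+1}$-Whittaker function $\Psi^{\mathfrak{gl}_{\ell+1}}_{\lambda}$ (both defined in the context) as follows: for all $x=(x_1,\ldots,x_{\ell+1})\in\mathbb{R}^{\ell+1}$, $${}^{\rm res}\Phi^{\mathfrak{gl}_{\ell+1}}_{\gamma(\lambda),\nu(\lambda)}(e^x)=e^{-x_{\ell+1}\sum_{i=1}^{\ell+1}\lambda_i}\ \Psi^{\mathfrak{gl}_{\ell+1}}_{\lambda}(e^x).$$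
   Context: $\mathbb{R}_+=(0,\infty)$; integration variables are $a_{k,i},b_{k,i}\in\mathbb{R}_+$, $1\le i\le k\le\ell$. Delta-factors: an expression $\int\prod_i\frac{dt_i}{t_i}F(t)\prod_\alpha\delta(c_\alpha\prod_j t_j^{l_j^\alpha}-1)$ with $c_\alpha>0$ and linearly independent integer vectors $l^\alpha$ means, in variables $T_i=\ln t_i$, $\int\prod_i dT_i\,F(e^T)\prod_\alpha\delta(\ln c_\alpha+\sum_j l_j^\alpha T_j)$, i.e. the value at $(-\ln c_\alpha)_\alpha$ of the continuous density of the push-forward of $F(e^T)dT$ under $T\mapsto(\sum_j l^\alpha_jT_j)_\alpha$. Whittaker function: the $\mathfrak{gl}_{\ell+1}$-Whittaker function is given, for $\mathrm{Re}(\lambda_i)>0$, by the integral $$\Psi^{\mathfrak{gl}_{\ell+1}}_{\lambda}(e^{x_1},\ldots,e^{x_{\ell+1}})=e^{x_{\ell+1}\sum_{i=1}^{\ell+1}\lambda_i}\int_{\mathbb{R}_+^{2d}}\prod_{1\le i\le k\le\ell}\frac{da_{k,i}}{a_{k,i}}\frac{db_{k,i}}{b_{k,i}}e^{-a_{k,i}-b_{k,i}}\prod_{1\le i\le k\le\ell}a_{k,i}^{\lambda_{k+1}}\prod_{k=1}^\ell b_{k,k}^{\sum_{i=1}^k\lambda_i}$$ $$\times\prod_{i=1}^\ell\delta\big(e^{-x_i+x_{i+1}}a_{\ell,i}b_{\ell,i}-1\big)\prod_{1\le i\le k<\ell}\delta\big(a_{k,i}b_{k,i}a_{k+1,i+1}^{-1}b_{k+1,i}^{-1}-1\big).$$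 GG-hypergeometric function: for real $y=(y_{k,i})$, $z=(z_{k,i})$ and complex $\gamma=(\gamma_{k,i})$, $\nu=(\nu_{k,i})$, $1\le i\le k\le\ell$, $$\Phi^{\mathfrak{gl}_{\ell+1}}_{\gamma,\nu}(e^y,e^z)=\int_{\mathbb{R}_+^{2d}}\prod_{1\le i\le k\le\ell}\frac{da_{k,i}}{a_{k,i}}\frac{db_{k,i}}{b_{k,i}}a_{k,i}^{\gamma_{k,i}}b_{k,i}^{\nu_{k,i}}e^{-a_{k,i}-b_{k,i}}\prod_{i=1}^\ell\delta\big(e^{-y_{\ell,i}-z_{\ell,i}}a_{\ell,i}b_{\ell,i}-1\big)$$ $$\times\prod_{1\le i\le k<\ell}\delta\big(e^{-y_{k,i}-z_{k,i}+y_{k+1,i+1}+z_{k+1,i}}a_{k,i}b_{k,i}a_{k+1,i+1}^{-1}b_{k+1,i}^{-1}-1\big).$$ It depends on $(y,z)$ only through the $d$ quantities $R_i(y,z)=y_{\ell,i}+z_{\ell,i}$ ($1\le i\le\ell$) and $B_{k,i}(y,z)=y_{k,i}+z_{k,i}-y_{k+1,i+1}-z_{k+1,i}$ ($1\le i\le k<\ell$). Restriction: ${}^{\rm res}\Phi^{\mathfrak{gl}_{\ell+1}}_{\gamma,\nu}(e^x)$ is the value of $\Phi^{\mathfrak{gl}_{\ell+1}}_{\gamma,\nu}(e^y,e^z)$ at any $(y,z)$ satisfying $R_i(y,z)=x_i-x_{i+1}$ for $1\le i\le\ell$ and $B_{k,i}(y,z)=0$ for $1\le i\le k<\ell$. 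*)

theory Defs
  imports "HOL-Analysis.Analysis"
begin

section \<open>Integrals with delta-factors\<close>

text \<open>
  A point of \<open>\<real>\<^sup>A\<close> (\<open>A\<close> a finite index set) is an element of \<open>\<Pi>\<^sub>E i\<in>A. UNIV\<close>, and Lebesgue measure on
  \<open>\<real>\<^sup>A\<close> is \<open>\<Pi>\<^sub>M i\<in>A. lborel\<close>.  The variables \<open>t\<^sub>j\<close> are indexed by \<open>j \<in> J\<close>, the delta-factors by
  \<open>\<alpha> \<in> A\<close>; \<open>l \<alpha>\<close> is the integer exponent vector of the \<open>\<alpha>\<close>-th factor.
\<close>

definition delta_map :: "'j set \<Rightarrow> 'a set \<Rightarrow> ('a \<Rightarrow> 'j \<Rightarrow> int) \<Rightarrow> ('j \<Rightarrow> real) \<Rightarrow> 'a \<Rightarrow> real" where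
  "delta_map J A l T = (\<lambda>\<alpha>\<in>A. \<Sum>j\<in>J. of_int (l \<alpha> j) * T j)"

definition exp_point :: "'j set \<Rightarrow> ('j \<Rightarrow> real) \<Rightarrow> 'j \<Rightarrow> real" where
  "exp_point J T = (\<lambda>j\<in>J. exp (T j))"

text \<open>
  \<open>g\<close> is the continuous density of the push-forward of \<open>F(e\<^sup>T) dT\<close> under \<open>delta_map\<close>.  The complex
  measure \<open>F(e\<^sup>T) dT\<close> need not be finite, so the push-forward is evaluated on bounded Borel sets only
  (this determines it as a locally finite complex measure).
\<close>

definition is_delta_density ::
  "'j set \<Rightarrow> 'a set \<Rightarrow> ('a \<Rightarrow> 'j \<Rightarrow> int) \<Rightarrow> (('j \<Rightarrow> real) \<Rightarrow> complex) \<Rightarrow> (('a \<Rightarrow> real) \<Rightarrow> complex) \<Rightarrow> bool"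
  where
  "is_delta_density J A l F g \<longleftrightarrow>
     continuous_on (\<Pi>\<^sub>E \<alpha>\<in>A. UNIV) g \<and>
     (\<forall>E \<in> sets (\<Pi>\<^sub>M \<alpha>\<in>A. lborel). (\<exists>r. E \<subseteq> (\<Pi>\<^sub>E \<alpha>\<in>A. {-r..r})) \<longrightarrow>
        set_integrable (\<Pi>\<^sub>M j\<in>J. lborel) {T. delta_map J A l T \<in> E} (\<lambda>T. F (exp_point J T)) \<and>
        (LINT T:{T. delta_map J A l T \<in> E}|(\<Pi>\<^sub>M j\<in>J. lborel). F (exp_point J T))
          = (LINT s:E|(\<Pi>\<^sub>M \<alpha>\<in>A. lborel). g s))"

text \<open>
  \<open>delta_integral J A l c F\<close> is
  \<open>\<integral> \<Prod>\<^sub>j dt\<^sub>j/t\<^sub>j F(t) \<Prod>\<^sub>\<alpha> \<delta>(c\<^sub>\<alpha> \<Prod>\<^sub>j t\<^sub>j\<^bsup>l \<alpha> j\<^esup> - 1)\<close>, for \<open>c\<^sub>\<alpha> > 0\<close> and linearly independent \<open>l \<alpha>\<close>.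
\<close>

definition delta_integral ::
  "'j set \<Rightarrow> 'a set \<Rightarrow> ('a \<Rightarrow> 'j \<Rightarrow> int) \<Rightarrow> ('a \<Rightarrow> real) \<Rightarrow> (('j \<Rightarrow> real) \<Rightarrow> complex) \<Rightarrow> complex" where
  "delta_integral J A l c F =
     (THE v. \<exists>g. is_delta_density J A l F g \<and> v = g (\<lambda>\<alpha>\<in>A. - ln (c \<alpha>)))"


section \<open>The Whittaker function and the GG-hypergeometric function\<close>

definition tri :: "nat \<Rightarrow> (nat \<times> nat) set" where
  "tri L = {(k, i). 1 \<le> i \<and> i \<le> k \<and> k \<le> L}"

text \<open>
  The integration variables are indexed by \<open>tri L <+> tri L\<close>: \<open>t (Inl (k, i))\<close> is \<open>a\<^bsub>k,i\<^esub>\<close> and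
  \<open>t (Inr (k, i))\<close> is \<open>b\<^bsub>k,i\<^esub>\<close>.  The delta-factors are indexed by \<open>tri L\<close>: the factor \<open>(L, i)\<close>
  involves \<open>a\<^bsub>L,i\<^esub> b\<^bsub>L,i\<^esub>\<close>, the factor \<open>(k, i)\<close> with \<open>k < L\<close> involves
  \<open>a\<^bsub>k,i\<^esub> b\<^bsub>k,i\<^esub> / (a\<^bsub>k+1,i+1\<^esub> b\<^bsub>k+1,i\<^esub>)\<close>.
\<close>

type_synonym tri_var = "(nat \<times> nat) + (nat \<times> nat)"

definition tri_exponent :: "nat \<Rightarrow> nat \<times> nat \<Rightarrow> tri_var \<Rightarrow> int" where
  "tri_exponent L = (\<lambda>(k, i) j.
     if j = Inl (k, i) \<or> j = Inr (k, i) then 1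
     else if k < L \<and> (j = Inl (k + 1, i + 1) \<or> j = Inr (k + 1, i)) then -1
     else 0)"

text \<open>
  \<open>L\<close> is the rank, \<open>lam\<close> the spectral parameter of \<open>\<Psi>\<close>.
  The functions are parametrised by the logarithms of their arguments: \<open>whittaker L lam x\<close> is
  \<open>\<Psi>\<^bsub>lam\<^esub>(e\<^bsup>x 1\<^esup>, \<dots>, e\<^bsup>x (L+1)\<^esup>)\<close> and \<open>gg_hyper L \<gamma> \<nu> y z\<close> is \<open>\<Phi>\<^bsub>\<gamma>,\<nu>\<^esub>(e\<^sup>y, e\<^sup>z)\<close>.
  Indices start at 1; values at other indices are irrelevant.
\<close>

definition whittaker_integrand :: "nat \<Rightarrow> (nat \<Rightarrow> complex) \<Rightarrow> (tri_var \<Rightarrow> real) \<Rightarrow> complex" where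
  "whittaker_integrand L lam t = (let a = (\<lambda>k i. t (Inl (k, i))); b = (\<lambda>k i. t (Inr (k, i))) in
     (\<Prod>(k, i)\<in>tri L. complex_of_real (exp (- a k i - b k i)))
     * (\<Prod>(k, i)\<in>tri L. complex_of_real (a k i) powr lam (k + 1))
     * (\<Prod>k=1..L. complex_of_real (b k k) powr (\<Sum>i=1..k. lam i)))"

definition whittaker_delta :: "nat \<Rightarrow> (nat \<Rightarrow> real) \<Rightarrow> nat \<times> nat \<Rightarrow> real" where
  "whittaker_delta L x = (\<lambda>(k, i). if k = L then exp (- x i + x (i + 1)) else 1)"

definition whittaker :: "nat \<Rightarrow> (nat \<Rightarrow> complex) \<Rightarrow> (nat \<Rightarrow> real) \<Rightarrow> complex" where
  "whittaker L lam x =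
     exp (complex_of_real (x (L + 1)) * (\<Sum>i=1..L+1. lam i))
     * delta_integral (tri L <+> tri L) (tri L) (tri_exponent L)
         (whittaker_delta L x) (whittaker_integrand L lam)"

definition gg_integrand ::
  "nat \<Rightarrow> (nat \<Rightarrow> nat \<Rightarrow> complex) \<Rightarrow> (nat \<Rightarrow> nat \<Rightarrow> complex) \<Rightarrow> (tri_var \<Rightarrow> real) \<Rightarrow> complex" where
  "gg_integrand L \<gamma> \<nu> t = (let a = (\<lambda>k i. t (Inl (k, i))); b = (\<lambda>k i. t (Inr (k, i))) in
     (\<Prod>(k, i)\<in>tri L. complex_of_real (a k i) powr \<gamma> k i * complex_of_real (b k i) powr \<nu> k i
                        * complex_of_real (exp (- a k i - b k i))))"

definition gg_delta ::
  "nat \<Rightarrow> (nat \<Rightarrow> nat \<Rightarrow> real) \<Rightarrow> (nat \<Rightarrow> nat \<Rightarrow> real) \<Rightarrow> nat \<times> nat \<Rightarrow> real" where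
  "gg_delta L y z = (\<lambda>(k, i).
     if k = L then exp (- y L i - z L i)
     else exp (- y k i - z k i + y (k + 1) (i + 1) + z (k + 1) i))"

definition gg_hyper ::
  "nat \<Rightarrow> (nat \<Rightarrow> nat \<Rightarrow> complex) \<Rightarrow> (nat \<Rightarrow> nat \<Rightarrow> complex)
     \<Rightarrow> (nat \<Rightarrow> nat \<Rightarrow> real) \<Rightarrow> (nat \<Rightarrow> nat \<Rightarrow> real) \<Rightarrow> complex" where
  "gg_hyper L \<gamma> \<nu> y z =
     delta_integral (tri L <+> tri L) (tri L) (tri_exponent L) (gg_delta L y z) (gg_integrand L \<gamma> \<nu>)"

definition gg_R :: "nat \<Rightarrow> (nat \<Rightarrow> nat \<Rightarrow> real) \<Rightarrow> (nat \<Rightarrow> nat \<Rightarrow> real) \<Rightarrow> nat \<Rightarrow> real" where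
  "gg_R L y z i = y L i + z L i"

definition gg_B :: "(nat \<Rightarrow> nat \<Rightarrow> real) \<Rightarrow> (nat \<Rightarrow> nat \<Rightarrow> real) \<Rightarrow> nat \<Rightarrow> nat \<Rightarrow> real" where
  "gg_B y z k i = y k i + z k i - y (k + 1) (i + 1) - z (k + 1) i"

definition res_point ::
  "nat \<Rightarrow> (nat \<Rightarrow> real) \<Rightarrow> (nat \<Rightarrow> nat \<Rightarrow> real) \<Rightarrow> (nat \<Rightarrow> nat \<Rightarrow> real) \<Rightarrow> bool" where
  "res_point L x y z \<longleftrightarrow>
     (\<forall>i. 1 \<le> i \<and> i \<le> L \<longrightarrow> gg_R L y z i = x i - x (i + 1)) \<and>
     (\<forall>k i. 1 \<le> i \<and> i \<le> k \<and> k < L \<longrightarrow> gg_B y z k i = 0)"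

text \<open>The restriction is the common value of \<open>gg_hyper\<close> at all \<open>(y, z)\<close> with \<open>res_point L x y z\<close>.\<close>

definition res_gg_hyper ::
  "nat \<Rightarrow> (nat \<Rightarrow> nat \<Rightarrow> complex) \<Rightarrow> (nat \<Rightarrow> nat \<Rightarrow> complex) \<Rightarrow> (nat \<Rightarrow> real) \<Rightarrow> complex" where
  "res_gg_hyper L \<gamma> \<nu> x = (THE v. \<exists>y z. res_point L x y z \<and> v = gg_hyper L \<gamma> \<nu> y z)"

definition special_gamma :: "(nat \<Rightarrow> complex) \<Rightarrow> nat \<Rightarrow> nat \<Rightarrow> complex" where
  "special_gamma lam k i = lam (k + 1)"

definition special_nu :: "(nat \<Rightarrow> complex) \<Rightarrow> nat \<Rightarrow> nat \<Rightarrow> complex" where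
  "special_nu lam k i = (if i = k then \<Sum>j=1..k. lam j else 0)"

section \<open>Well-definedness of the delta-integrals\<close>

text \<open>
  The continuous density is unique (\<open>delta_density_unique\<close>), and it exists for both integrands
  (\<open>is_delta_density_gg\<close>, for all complex \<open>\<gamma>\<close>, \<open>\<nu>\<close>, and \<open>whittaker_density_exists\<close>), so the definite
  descriptions above denote genuine values.
\<close>

abbreviation lebR :: "'j set \<Rightarrow> ('j \<Rightarrow> real) measure" where
  "lebR J \<equiv> Pi\<^sub>M J (\<lambda>_. lborel)"

lemma product_sigma_finite_lborel: "product_sigma_finite (\<lambda>_. lborel :: real measure)"
  by (simp add: product_sigma_finite.intro lborel.sigma_finite_measure_axioms)

lemma tendsto_fun_iff:
  fixes u :: "nat \<Rightarrow> 'a \<Rightarrow> real"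
  shows "u \<longlonglongrightarrow> a \<longleftrightarrow> (\<forall>i. (\<lambda>n. u n i) \<longlonglongrightarrow> a i)"
proof -
  have "u \<longlonglongrightarrow> a \<longleftrightarrow> limitin (product_topology (\<lambda>i. euclidean) UNIV) u a sequentially"
    by (simp add: euclidean_product_topology)
  then show ?thesis by (simp add: limitin_componentwise)
qed

lemma borel_measurable_continuous_lebR:
  fixes g :: "('a::countable \<Rightarrow> real) \<Rightarrow> complex"
  assumes g: "continuous_on (\<Pi>\<^sub>E i\<in>A. UNIV) g"
  shows "g \<in> borel_measurable (lebR A)"
proof -
  have c: "continuous_on UNIV (\<lambda>x::'a \<Rightarrow> real. restrict x A)"
  proof (rule continuous_on_coordinatewise_then_product)
    fix i
    show "continuous_on UNIV (\<lambda>x::'a \<Rightarrow> real. restrict x A i)"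
      by (cases "i \<in> A") (auto intro!: continuous_on_product_then_coordinatewise continuous_on_id)
  qed
  have "continuous_on UNIV (\<lambda>x. g (restrict x A))"
    by (rule continuous_on_compose2[OF g c]) auto
  then have h: "(\<lambda>x. g (restrict x A)) \<in> borel_measurable borel"
    by (rule borel_measurable_continuous_onI)
  have m: "(\<lambda>x i. if i \<in> A then x i else undefined) \<in> borel_measurable (lebR A)"
  proof (rule measurable_coordinatewise_then_product)
    fix i
    show "(\<lambda>x. if i \<in> A then x i else undefined) \<in> borel_measurable (lebR A)"
      by (cases "i \<in> A") auto
  qed
  have "(\<lambda>x. g (restrict (\<lambda>i. if i \<in> A then x i else undefined) A)) \<in> borel_measurable (lebR A)"
    using measurable_compose[OF m h] by simp
  moreover have "g (restrict (\<lambda>i. if i \<in> A then x i else undefined) A) = g x"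
    if "x \<in> space (lebR A)" for x
  proof -
    have "restrict (\<lambda>i. if i \<in> A then x i else undefined) A = x"
      using that by (auto simp: space_PiM PiE_def extensional_def)
    then show ?thesis by simp
  qed
  ultimately show ?thesis
    by (subst measurable_cong[where g = "\<lambda>x. g (restrict (\<lambda>i. if i \<in> A then x i else undefined) A)"]) auto
qed

lemma delta_density_unique:
  fixes A :: "'a::countable set"
  assumes A: "finite A"
    and g1: "is_delta_density J A l F g1" and g2: "is_delta_density J A l F g2"
    and s: "s \<in> (\<Pi>\<^sub>E i\<in>A. UNIV)"
  shows "g1 s = g2 s"
proof (rule ccontr)
  interpret product_sigma_finite "\<lambda>_::'a. lborel :: real measure"
    by (rule product_sigma_finite_lborel)
  define h where "h = (\<lambda>x. g1 x - g2 x)"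
  assume "g1 s \<noteq> g2 s"
  then have hs: "norm (h s) > 0" by (simp add: h_def)
  have c1: "continuous_on (\<Pi>\<^sub>E i\<in>A. UNIV) g1" and c2: "continuous_on (\<Pi>\<^sub>E i\<in>A. UNIV) g2"
    using g1 g2 by (auto simp: is_delta_density_def)
  have ch: "continuous_on (\<Pi>\<^sub>E i\<in>A. UNIV) h"
    unfolding h_def by (intro continuous_on_diff c1 c2)
  note [measurable] = borel_measurable_continuous_lebR[OF c1]
    borel_measurable_continuous_lebR[OF c2] borel_measurable_continuous_lebR[OF ch]
  define E where "E = (\<lambda>n::nat. \<Pi>\<^sub>E i\<in>A. {s i - 1 / Suc n .. s i + 1 / Suc n})"
  have "\<exists>n. \<forall>x\<in>E n. norm (h x - h s) < norm (h s) / 2"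
  proof (rule ccontr)
    assume "\<not> ?thesis"
    then have "\<forall>n. \<exists>x. x \<in> E n \<and> norm (h x - h s) \<ge> norm (h s) / 2"
      by (meson not_less)
    from choice[OF this] obtain x
      where x: "\<And>n. x n \<in> E n" "\<And>n. norm (h (x n) - h s) \<ge> norm (h s) / 2"
      by (auto simp only:)
    have "x \<longlonglongrightarrow> s"
      unfolding tendsto_fun_iff
    proof
      fix i
      show "(\<lambda>n. x n i) \<longlonglongrightarrow> s i"
      proof (cases "i \<in> A")
        case True
        have "(\<lambda>n. x n i - s i) \<longlonglongrightarrow> 0"
        proof (rule tendsto_rabs_zero_cancel, rule tendsto_sandwich[where f = "\<lambda>_. 0"])
          show "\<forall>\<^sub>F n in sequentially. 0 \<le> \<bar>x n i - s i\<bar>" by simp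
          show "\<forall>\<^sub>F n in sequentially. \<bar>x n i - s i\<bar> \<le> 1 / real (Suc n)"
          proof (rule always_eventually, rule allI)
            fix n
            have "x n i \<in> {s i - 1 / real (Suc n) .. s i + 1 / real (Suc n)}"
              using x(1)[of n] True unfolding E_def by (rule PiE_mem)
            then show "\<bar>x n i - s i\<bar> \<le> 1 / real (Suc n)"
              unfolding atLeastAtMost_iff by linarith
          qed
          show "(\<lambda>n. 1 / real (Suc n)) \<longlonglongrightarrow> 0"
            using LIMSEQ_inverse_real_of_nat unfolding inverse_eq_divide .
        qed simp
        then show ?thesis by (rule LIM_zero_cancel)
      next
        case False
        have "x n i = undefined" for n
          using x(1)[of n] False unfolding E_def by (rule PiE_arb)
        moreover have "s i = undefined" using s False by (rule PiE_arb)
        ultimately show ?thesis by simp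
      qed
    qed
    moreover have "x n \<in> (\<Pi>\<^sub>E i\<in>A. UNIV)" for n
    proof -
      have "E n \<subseteq> (\<Pi>\<^sub>E i\<in>A. UNIV)" unfolding E_def by (rule PiE_mono) simp
      then show ?thesis using x(1) by blast
    qed
    ultimately have "(\<lambda>n. h (x n)) \<longlonglongrightarrow> h s"
      using ch s unfolding continuous_on_sequentially by (auto simp: comp_def)
    then have "(\<lambda>n. norm (h (x n) - h s)) \<longlonglongrightarrow> 0"
      by (intro tendsto_norm_zero LIM_zero)
    then have "norm (h s) / 2 \<le> 0"
      by (rule LIMSEQ_le_const) (use x(2) in blast)
    then show False using hs by simp
  qed
  then obtain n where n: "\<And>x. x \<in> E n \<Longrightarrow> norm (h x - h s) < norm (h s) / 2" by blast
  have E[measurable]: "E n \<in> sets (lebR A)"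
    unfolding E_def using A by (intro sets_PiM_I_finite) auto
  define \<rho> where "\<rho> = 1 / real (Suc n)"
  have \<rho>: "\<rho> > 0" "\<rho> \<le> 1" by (auto simp: \<rho>_def)
  have E\<rho>: "E n = (\<Pi>\<^sub>E i\<in>A. {s i - \<rho> .. s i + \<rho>})" by (simp only: E_def \<rho>_def)
  have em: "emeasure (lebR A) (E n) = ennreal ((2 * \<rho>) ^ card A)"
  proof -
    have "emeasure (lebR A) (E n) = (\<Prod>i\<in>A. emeasure lborel {s i - \<rho> .. s i + \<rho>})"
      unfolding E\<rho> using A by (intro emeasure_PiM) auto
    also have "\<dots> = (\<Prod>i\<in>A. ennreal (2 * \<rho>))"
      using \<rho> by (intro prod.cong) auto
    also have "\<dots> = ennreal ((2 * \<rho>) ^ card A)"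
      using \<rho> by (simp add: ennreal_power)
    finally show ?thesis .
  qed
  have fin: "emeasure (lebR A) (E n) < \<infinity>" by (simp add: em)
  have mpos: "measure (lebR A) (E n) > 0" using \<rho> by (simp add: measure_def em)
  define r where "r = (\<Sum>i\<in>A. \<bar>s i\<bar>) + 1"
  have "E n \<subseteq> (\<Pi>\<^sub>E \<alpha>\<in>A. {-r..r})"
  proof -
    have "{s i - \<rho> .. s i + \<rho>} \<subseteq> {-r..r}" if "i \<in> A" for i
    proof -
      have "\<bar>s i\<bar> \<le> (\<Sum>i\<in>A. \<bar>s i\<bar>)"
        using A that by (intro member_le_sum) auto
      then show ?thesis using \<rho> unfolding r_def by auto
    qed
    then show ?thesis unfolding E\<rho> by (intro PiE_mono) auto
  qed
  then have eq: "(LINT s:E n|lebR A. g1 s) = (LINT s:E n|lebR A. g2 s)"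
    using g1 g2 E by (metis is_delta_density_def)
  have ih: "set_integrable (lebR A) (E n) (\<lambda>x. h x - h s)"
    unfolding set_integrable_def
  proof (rule Bochner_Integration.integrable_bound)
    show "integrable (lebR A) (\<lambda>x. indicator (E n) x *\<^sub>R (norm (h s) / 2))"
      using fin by (intro integrable_scaleR_left integrable_real_indicator) auto
    show "AE x in lebR A. norm (indicator (E n) x *\<^sub>R (h x - h s))
        \<le> norm (indicator (E n) x *\<^sub>R (norm (h s) / 2))"
      using n by (intro AE_I2) (auto simp: indicator_def less_imp_le)
  qed measurable
  have bound: "norm (LINT x:E n|lebR A. h x - h s) \<le> norm (h s) / 2 * measure (lebR A) (E n)"
  proof -
    have "norm (LINT x:E n|lebR A. h x - h s)
        \<le> (LINT x|lebR A. norm (indicator (E n) x *\<^sub>R (h x - h s)))"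
      unfolding set_lebesgue_integral_def by (rule integral_norm_bound)
    also have "\<dots> \<le> (LINT x|lebR A. indicator (E n) x *\<^sub>R (norm (h s) / 2))"
    proof (rule integral_mono)
      show "integrable (lebR A) (\<lambda>x. norm (indicator (E n) x *\<^sub>R (h x - h s)))"
        using ih unfolding set_integrable_def by (rule integrable_norm)
      show "integrable (lebR A) (\<lambda>x. indicator (E n) x *\<^sub>R (norm (h s) / 2))"
        using fin by (intro integrable_scaleR_left integrable_real_indicator) auto
    qed (use n in \<open>auto simp: indicator_def less_imp_le\<close>)
    also have "\<dots> = norm (h s) / 2 * measure (lebR A) (E n)"
      using fin by simp
    finally show ?thesis .
  qed
  have ic: "set_integrable (lebR A) (E n) (\<lambda>x. c)" for c :: complex
    using fin unfolding set_integrable_def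
    by (intro integrable_scaleR_left integrable_real_indicator) auto
  have bg: "set_integrable (lebR A) (E n) (\<lambda>x. h x)"
    using set_integral_add(1)[OF ih ic[of "h s"]] by simp
  have bnd: "(LINT x:E n|lebR A. h x) = (LINT x:E n|lebR A. h x - h s) + h s * measure (lebR A) (E n)"
  proof -
    have "(LINT x:E n|lebR A. h x) = (LINT x:E n|lebR A. (h x - h s) + h s)" by simp
    also have "\<dots> = (LINT x:E n|lebR A. h x - h s) + (LINT x:E n|lebR A. h s)"
      by (rule set_integral_add(2)[OF ih ic])
    also have "(LINT x:E n|lebR A. h s) = h s * measure (lebR A) (E n)"
      using fin by (simp add: set_lebesgue_integral_def scaleR_conv_of_real)
    finally show ?thesis .
  qed
  have "(LINT x:E n|lebR A. h x) = 0"
  proof -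
    have bdd: "set_integrable (lebR A) (E n) g" if g: "continuous_on (\<Pi>\<^sub>E i\<in>A. UNIV) g"
      for g :: "('a \<Rightarrow> real) \<Rightarrow> complex"
    proof -
      note [measurable] = borel_measurable_continuous_lebR[OF g]
      have "compact (E n)"
      proof -
        have "compactin (product_topology (\<lambda>i. euclidean) UNIV)
            (\<Pi>\<^sub>E i\<in>UNIV. if i \<in> A then {s i - \<rho> .. s i + \<rho>} else {undefined})"
          by (subst compactin_PiE) auto
        moreover have "(\<Pi>\<^sub>E i\<in>UNIV. if i \<in> A then {s i - \<rho> .. s i + \<rho>} else {undefined}) = E n"
          unfolding E\<rho> by (force simp: PiE_iff extensional_def split: if_splits)
        ultimately show ?thesis by (simp add: euclidean_product_topology)
      qed
      moreover have "E n \<subseteq> (\<Pi>\<^sub>E i\<in>A. UNIV)" unfolding E_def by (intro PiE_mono) auto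
      ultimately have "compact (g ` E n)"
        using g by (meson compact_continuous_image continuous_on_subset)
      then obtain K where K: "\<And>x. x \<in> E n \<Longrightarrow> norm (g x) \<le> K"
        by (metis bounded_iff compact_imp_bounded imageI)
      show ?thesis unfolding set_integrable_def
      proof (rule Bochner_Integration.integrable_bound)
        show "integrable (lebR A) (\<lambda>x. indicator (E n) x *\<^sub>R K)"
          using fin by (intro integrable_scaleR_left integrable_real_indicator) auto
        show "AE x in lebR A. norm (indicator (E n) x *\<^sub>R g x) \<le> norm (indicator (E n) x *\<^sub>R K)"
          using order_trans[OF K abs_ge_self] by (intro AE_I2) (auto simp: indicator_def)
      qed measurable
    qed
    show ?thesis
      unfolding h_def using set_integral_diff(2)[OF bdd[OF c1] bdd[OF c2]] eq by simp
  qed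
  then have "norm (h s) * measure (lebR A) (E n) = norm (LINT x:E n|lebR A. h x - h s)"
    using bnd by (metis add_eq_0_iff2 norm_minus_cancel norm_mult norm_of_real abs_of_nonneg measure_nonneg)
  with bound have "norm (h s) * measure (lebR A) (E n) \<le> norm (h s) / 2 * measure (lebR A) (E n)"
    by (simp only:)
  moreover have "0 < norm (h s) * measure (lebR A) (E n)" using hs mpos by (rule mult_pos_pos)
  ultimately show False by linarith
qed

lemma delta_integral_eqI:
  fixes A :: "'a::countable set"
  assumes "finite A" "is_delta_density J A l F g"
  shows "delta_integral J A l c F = g (\<lambda>\<alpha>\<in>A. - ln (c \<alpha>))"
  unfolding delta_integral_def
proof (rule the_equality)
  fix v assume "\<exists>g. is_delta_density J A l F g \<and> v = g (\<lambda>\<alpha>\<in>A. - ln (c \<alpha>))"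
  then show "v = g (\<lambda>\<alpha>\<in>A. - ln (c \<alpha>))"
    using delta_density_unique[OF assms(1) _ assms(2)] by fastforce
qed (use assms in auto)

lemma finite_tri [simp]: "finite (tri L)"
proof (rule finite_subset)
  show "tri L \<subseteq> {..L} \<times> {..L}" by (auto simp: tri_def)
qed simp

lemma shear_step:
  fixes J :: "'j set" and h :: "('j \<Rightarrow> real) \<Rightarrow> real"
  assumes J: "finite J" "j \<in> J"
    and h[measurable]: "h \<in> borel_measurable (lebR J)"
    and indep: "\<And>T T'. (\<And>i. i \<in> J \<Longrightarrow> i \<noteq> j \<Longrightarrow> T i = T' i) \<Longrightarrow> h T = h T'"
  shows "distr (lebR J) (lebR J) (\<lambda>T. T(j := T j + h T)) = lebR J"
proof (rule measure_eqI)
  interpret product_sigma_finite "\<lambda>_::'j. lborel :: real measure"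
    by (rule product_sigma_finite_lborel)
  define I where "I = J - {j}"
  have I: "finite I" "j \<notin> I" "insert j I = J" using J by (auto simp: I_def)
  have M[measurable]: "(\<lambda>T. T(j := T j + h T)) \<in> measurable (lebR J) (lebR J)"
  proof -
    have "(\<lambda>T. T(j := T j + h T)) \<in> measurable (lebR J) (lebR (insert j J))"
      using J by (intro measurable_fun_upd[where J = J]) auto
    then show ?thesis using J by (simp add: insert_absorb)
  qed
  show "sets (distr (lebR J) (lebR J) (\<lambda>T. T(j := T j + h T))) = sets (lebR J)" by simp
  fix A assume "A \<in> sets (distr (lebR J) (lebR J) (\<lambda>T. T(j := T j + h T)))"
  then have A[measurable]: "A \<in> sets (lebR J)" by simp
  have "emeasure (distr (lebR J) (lebR J) (\<lambda>T. T(j := T j + h T))) A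
      = (\<integral>\<^sup>+T. indicator A T \<partial>distr (lebR J) (lebR J) (\<lambda>T. T(j := T j + h T)))"
    by simp
  also have "\<dots> = (\<integral>\<^sup>+T. indicator A (T(j := T j + h T)) \<partial>lebR J)"
    by (subst nn_integral_distr) auto
  also have "\<dots> = (\<integral>\<^sup>+x. (\<integral>\<^sup>+y. indicator A ((x(j := y))(j := y + h (x(j := y)))) \<partial>lborel) \<partial>lebR I)"
    by (subst (1) I(3)[symmetric], subst product_nn_integral_insert) (use I in auto)
  also have "\<dots> = (\<integral>\<^sup>+x. (\<integral>\<^sup>+y. indicator A (x(j := y)) \<partial>lborel) \<partial>lebR I)"
  proof (rule nn_integral_cong)
    fix x assume x: "x \<in> space (lebR I)"
    have [measurable]: "(\<lambda>y. x(j := y)) \<in> measurable borel (lebR J)"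
      using measurable_component_update[OF x I(2)] I(3) by (simp add: comp_def)
    have hy: "h (x(j := y)) = h (x(j := 0))" for y by (rule indep) auto
    have "(\<integral>\<^sup>+y. indicator A ((x(j := y))(j := y + h (x(j := y)))) \<partial>lborel)
       = (\<integral>\<^sup>+y. indicator A (x(j := h (x(j := 0)) + 1 * y)) \<partial>lborel)"
      by (subst hy) (simp add: add.commute)
    also have "\<dots> = (\<integral>\<^sup>+y. indicator A (x(j := y)) \<partial>lborel)"
      by (subst (2) nn_integral_real_affine[where c = 1 and t = "h (x(j := 0))"]) auto
    finally show "(\<integral>\<^sup>+y. indicator A ((x(j := y))(j := y + h (x(j := y)))) \<partial>lborel)
       = (\<integral>\<^sup>+y. indicator A (x(j := y)) \<partial>lborel)" .
  qed
  also have "\<dots> = (\<integral>\<^sup>+T. indicator A T \<partial>lebR (insert j I))"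
    by (subst product_nn_integral_insert) (use I in auto)
  also have "\<dots> = emeasure (lebR J) A" using I(3) by simp
  finally show "emeasure (distr (lebR J) (lebR J) (\<lambda>T. T(j := T j + h T))) A = emeasure (lebR J) A" .
qed

text \<open>A triangular unipotent change of variables preserves Lebesgue measure.\<close>

lemma distr_shear:
  fixes J :: "'j set" and h :: "'j \<Rightarrow> ('j \<Rightarrow> real) \<Rightarrow> real" and r :: "'j \<Rightarrow> nat"
  assumes J: "finite J" and K: "K \<subseteq> J"
    and h[measurable]: "\<And>j. j \<in> J \<Longrightarrow> h j \<in> borel_measurable (lebR J)"
    and indep: "\<And>j T T'. j \<in> J \<Longrightarrow> (\<And>i. i \<in> J \<Longrightarrow> r j < r i \<Longrightarrow> T i = T' i) \<Longrightarrow> h j T = h j T'"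
  shows "distr (lebR J) (lebR J) (\<lambda>T. \<lambda>j\<in>J. if j \<in> K then T j + h j T else T j) = lebR J"
proof -
  define \<Theta> where "\<Theta> = (\<lambda>K (T::'j \<Rightarrow> real). \<lambda>j\<in>J. if j \<in> K then T j + h j T else T j)"
  have meas[measurable]: "\<Theta> K \<in> measurable (lebR J) (lebR J)" for K
    unfolding \<Theta>_def by (intro measurable_restrict measurable_If_set) auto
  have "finite K" using J K by (rule finite_subset[rotated])
  then have "K \<subseteq> J \<longrightarrow> distr (lebR J) (lebR J) (\<Theta> K) = lebR J"
  proof (induction K rule: finite_ranking_induct[where f = r])
    case empty
    have "distr (lebR J) (lebR J) (\<Theta> {}) = distr (lebR J) (lebR J) (\<lambda>T. T)"
      by (rule distr_cong) (auto simp: \<Theta>_def space_PiM PiE_def extensional_restrict)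
    then show ?case by (simp add: distr_id)
  next
    case (insert j K)
    show ?case
    proof (cases "j \<in> K")
      case True
      then show ?thesis using insert by (simp add: insert_absorb)
    next
      case False
      show ?thesis
      proof
        assume sub: "insert j K \<subseteq> J"
        then have j: "j \<in> J" by simp
        have st: "distr (lebR J) (lebR J) (\<lambda>T. T(j := T j + h j T)) = lebR J"
          by (rule shear_step[OF J j h[OF j]]) (rule indep[OF j], auto)
        have M[measurable]: "(\<lambda>T. T(j := T j + h j T)) \<in> measurable (lebR J) (lebR J)"
        proof -
          have "(\<lambda>T. T(j := T j + h j T)) \<in> measurable (lebR J) (lebR (insert j J))"
            using j h[OF j] by (intro measurable_fun_upd[where J = J]) auto
          then show ?thesis using j by (simp add: insert_absorb)
        qed
        have eq: "\<Theta> (insert j K) = (\<lambda>T. T(j := T j + h j T)) \<circ> \<Theta> K"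
        proof
          fix T
          have "h j (\<Theta> K T) = h j T"
          proof (rule indep[OF j])
            fix i assume "i \<in> J" "r j < r i"
            moreover from this have "i \<notin> K" using insert.hyps(2)[of i] by auto
            ultimately show "\<Theta> K T i = T i" by (simp add: \<Theta>_def)
          qed
          then show "\<Theta> (insert j K) T = ((\<lambda>T. T(j := T j + h j T)) \<circ> \<Theta> K) T"
            using j False by (auto simp: \<Theta>_def fun_eq_iff)
        qed
        have "distr (lebR J) (lebR J) (\<Theta> (insert j K))
           = distr (distr (lebR J) (lebR J) (\<Theta> K)) (lebR J) (\<lambda>T. T(j := T j + h j T))"
          unfolding eq by (subst distr_distr) auto
        then show "distr (lebR J) (lebR J) (\<Theta> (insert j K)) = lebR J"
          using insert.IH sub st by simp
      qed
    qed
  qed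
  then show ?thesis using K unfolding \<Theta>_def by blast
qed

definition sum_point :: "'a set \<Rightarrow> 'b set \<Rightarrow> ('a \<Rightarrow> real) \<times> ('b \<Rightarrow> real) \<Rightarrow> 'a + 'b \<Rightarrow> real" where
  "sum_point A B = (\<lambda>(u, v). \<lambda>j\<in>A <+> B. case_sum u v j)"

lemma measurable_sum_point [measurable]:
  "sum_point A B \<in> measurable (lebR A \<Otimes>\<^sub>M lebR B) (lebR (A <+> B))"
proof -
  have "(\<lambda>x. \<lambda>j\<in>A <+> B. case_sum (fst x) (snd x) j) \<in> measurable (lebR A \<Otimes>\<^sub>M lebR B) (lebR (A <+> B))"
  proof (rule measurable_restrict)
    fix j assume "j \<in> A <+> B"
    then show "(\<lambda>x. case_sum (fst x) (snd x) j) \<in> measurable (lebR A \<Otimes>\<^sub>M lebR B) lborel"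
      by (cases j) auto
  qed
  then show ?thesis by (simp add: sum_point_def case_prod_unfold)
qed

lemma distr_sum_point:
  fixes A :: "'a set" and B :: "'b set"
  assumes fin: "finite A" "finite B"
  shows "distr (lebR A \<Otimes>\<^sub>M lebR B) (lebR (A <+> B)) (sum_point A B) = lebR (A <+> B)"
proof -
  interpret A: product_sigma_finite "\<lambda>_::'a. lborel :: real measure"
    by (rule product_sigma_finite_lborel)
  interpret B: product_sigma_finite "\<lambda>_::'b. lborel :: real measure"
    by (rule product_sigma_finite_lborel)
  interpret S: product_sigma_finite "\<lambda>_::'a+'b. lborel :: real measure"
    by (rule product_sigma_finite_lborel)
  have ball_Plus: "(\<forall>i\<in>A <+> B. P i) \<longleftrightarrow> (\<forall>a\<in>A. P (Inl a)) \<and> (\<forall>b\<in>B. P (Inr b))"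
    for P :: "'a + 'b \<Rightarrow> bool" by auto
  interpret BB: sigma_finite_measure "lebR B" using B.sigma_finite fin by blast
  show ?thesis
  proof (rule S.PiM_eqI)
    show "finite (A <+> B)" using fin by simp
    fix E :: "'a + 'b \<Rightarrow> real set" assume E: "\<And>i. i \<in> A <+> B \<Longrightarrow> E i \<in> sets lborel"
    have box: "Pi\<^sub>E (A <+> B) E \<in> sets (lebR (A <+> B))"
      using fin E by (intro sets_PiM_I_finite) auto
    have pre: "sum_point A B -` Pi\<^sub>E (A <+> B) E \<inter> space (lebR A \<Otimes>\<^sub>M lebR B)
        = Pi\<^sub>E A (E \<circ> Inl) \<times> Pi\<^sub>E B (E \<circ> Inr)"
      by (auto simp: sum_point_def space_pair_measure space_PiM PiE_iff ball_Plus)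
    have "emeasure (distr (lebR A \<Otimes>\<^sub>M lebR B) (lebR (A <+> B)) (sum_point A B)) (Pi\<^sub>E (A <+> B) E)
       = emeasure (lebR A \<Otimes>\<^sub>M lebR B) (Pi\<^sub>E A (E \<circ> Inl) \<times> Pi\<^sub>E B (E \<circ> Inr))"
      using box by (subst emeasure_distr) (auto simp: pre)
    also have "\<dots> = emeasure (lebR A) (Pi\<^sub>E A (E \<circ> Inl)) * emeasure (lebR B) (Pi\<^sub>E B (E \<circ> Inr))"
      using fin E by (intro BB.emeasure_pair_measure_Times sets_PiM_I_finite) auto
    also have "\<dots> = (\<Prod>i\<in>A <+> B. emeasure lborel (E i))"
      using fin E by (simp add: A.emeasure_PiM B.emeasure_PiM prod.Plus InlI InrI)
    finally show "emeasure (distr (lebR A \<Otimes>\<^sub>M lebR B) (lebR (A <+> B)) (sum_point A B)) (Pi\<^sub>E (A <+> B) E)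
       = (\<Prod>i\<in>A <+> B. emeasure lborel (E i))" .
  qed simp
qed

lemma integrable_exp_neg_abs: "integrable lborel (\<lambda>x::real. exp (- \<bar>x\<bar>))"
proof -
  have "(\<integral>\<^sup>+x. ennreal (exp (- x)) * indicator {0::real..} x \<partial>lborel) = ennreal (0 - (- exp (- 0)))"
  proof (rule nn_integral_FTC_atLeast[where F = "\<lambda>x. - exp (- x)"])
    show "((\<lambda>x::real. - exp (- x)) \<longlongrightarrow> 0) at_top"
      using tendsto_minus[OF filterlim_compose[OF exp_at_bot filterlim_uminus_at_bot_at_top]] by simp
  qed (auto intro!: derivative_eq_intros)
  then have *: "(\<integral>\<^sup>+x. ennreal (exp (- x)) * indicator {0::real..} x \<partial>lborel) = 1" by simp
  have **: "(\<integral>\<^sup>+x. ennreal (exp x) * indicator {..0::real} x \<partial>lborel) = 1"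
  proof -
    have "(\<integral>\<^sup>+x. ennreal (exp x) * indicator {..0::real} x \<partial>lborel)
        = (\<integral>\<^sup>+x. ennreal (exp (- x)) * indicator {0::real..} x \<partial>lborel)"
      by (subst nn_integral_real_affine[where c = "-1" and t = 0])
        (auto simp: indicator_def intro!: nn_integral_cong)
    then show ?thesis using * by simp
  qed
  have "(\<integral>\<^sup>+x. ennreal (norm (exp (- \<bar>x::real\<bar>))) \<partial>lborel)
     \<le> (\<integral>\<^sup>+x. ennreal (exp (- x)) * indicator {0::real..} x + ennreal (exp x) * indicator {..0::real} x \<partial>lborel)"
    by (rule nn_integral_mono) (auto simp: indicator_def)
  also have "\<dots> = 1 + 1" by (subst nn_integral_add) (auto simp: * **)
  also have "\<dots> < \<infinity>" by simp
  finally show ?thesis by (auto simp: integrable_iff_bounded)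
qed

lemma delta_map_tri:
  assumes "(k, i) \<in> tri L"
  shows "delta_map (tri L <+> tri L) (tri L) (tri_exponent L) T (k, i)
    = T (Inl (k, i)) + T (Inr (k, i))
      - (if k < L then T (Inl (k + 1, i + 1)) + T (Inr (k + 1, i)) else 0)"
proof -
  have l: "(\<Sum>q\<in>tri L. of_int (tri_exponent L (k, i) (Inl q)) * T (Inl q))
     = T (Inl (k, i)) - (if k < L then T (Inl (k + 1, i + 1)) else 0)"
  proof -
    have "(\<Sum>q\<in>tri L. of_int (tri_exponent L (k, i) (Inl q)) * T (Inl q))
      = (\<Sum>q\<in>tri L. (if q = (k, i) then T (Inl q) else 0)
           - (if q = (k + 1, i + 1) then if k < L then T (Inl q) else 0 else 0))"
      by (intro sum.cong) (auto simp: tri_exponent_def)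
    also have "\<dots> = T (Inl (k, i)) - (if k < L then T (Inl (k + 1, i + 1)) else 0)"
      using assms by (simp add: sum_subtractf sum.delta) (auto simp: tri_def)
    finally show ?thesis .
  qed
  have r: "(\<Sum>q\<in>tri L. of_int (tri_exponent L (k, i) (Inr q)) * T (Inr q))
     = T (Inr (k, i)) - (if k < L then T (Inr (k + 1, i)) else 0)"
  proof -
    have "(\<Sum>q\<in>tri L. of_int (tri_exponent L (k, i) (Inr q)) * T (Inr q))
      = (\<Sum>q\<in>tri L. (if q = (k, i) then T (Inr q) else 0)
           - (if q = (k + 1, i) then if k < L then T (Inr q) else 0 else 0))"
      by (intro sum.cong) (auto simp: tri_exponent_def)
    also have "\<dots> = T (Inr (k, i)) - (if k < L then T (Inr (k + 1, i)) else 0)"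
      using assms by (simp add: sum_subtractf sum.delta) (auto simp: tri_def)
    finally show ?thesis .
  qed
  show ?thesis
    using assms by (simp add: delta_map_def sum.Plus l r)
qed

lemma measurable_delta_map [measurable]:
  "delta_map J A l \<in> measurable (lebR J) (lebR A)"
  unfolding delta_map_def by measurable

text \<open>The linear change of variables replacing \<open>ln b\<^bsub>k,i\<^esub>\<close> by the \<open>(k, i)\<close>-th linear form, and its inverse.\<close>

definition tri_fwd :: "nat \<Rightarrow> (tri_var \<Rightarrow> real) \<Rightarrow> tri_var \<Rightarrow> real" where
  "tri_fwd L T = (\<lambda>j\<in>tri L <+> tri L. case j of Inl p \<Rightarrow> T (Inl p)
     | Inr p \<Rightarrow> delta_map (tri L <+> tri L) (tri L) (tri_exponent L) T p)"

definition tri_inv :: "nat \<Rightarrow> (tri_var \<Rightarrow> real) \<Rightarrow> tri_var \<Rightarrow> real" where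
  "tri_inv L T = (\<lambda>j\<in>tri L <+> tri L. case j of Inl p \<Rightarrow> T (Inl p)
     | Inr (k, i) \<Rightarrow> (\<Sum>m=k..L. T (Inr (m, i)) - T (Inl (m, i))) + (\<Sum>m=k..<L. T (Inl (m + 1, i + 1))))"

lemma tri_inv_Inl: "p \<in> tri L \<Longrightarrow> tri_inv L T (Inl p) = T (Inl p)"
  by (simp add: tri_inv_def InlI)

lemma tri_inv_Inr: "(k, i) \<in> tri L \<Longrightarrow> tri_inv L T (Inr (k, i)) =
   (\<Sum>m=k..L. T (Inr (m, i)) - T (Inl (m, i))) + (\<Sum>m=k..<L. T (Inl (m + 1, i + 1)))"
  by (simp add: tri_inv_def InrI)

lemma tri_inv_fwd:
  assumes "T \<in> extensional (tri L <+> tri L)"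
  shows "tri_inv L (tri_fwd L T) = T"
proof
  fix j
  have V: "(\<Sum>m=k..L. tri_fwd L T (Inr (m, i)) - tri_fwd L T (Inl (m, i)))
      + (\<Sum>m=k..<L. tri_fwd L T (Inl (m + 1, i + 1))) = T (Inr (k, i))"
    if "k \<le> L" "1 \<le> i" "i \<le> k" for k i
    using that
  proof (induction k rule: inc_induct)
    case base
    then have "(L, i) \<in> tri L" by (simp add: tri_def)
    then show ?case
      by (simp add: tri_fwd_def InlI InrI delta_map_tri)
  next
    case (step n)
    then have mem: "(n, i) \<in> tri L" "(Suc n, Suc i) \<in> tri L" by (auto simp: tri_def)
    have IH: "(\<Sum>m=Suc n..L. tri_fwd L T (Inr (m, i)) - tri_fwd L T (Inl (m, i)))
      + (\<Sum>m=Suc n..<L. tri_fwd L T (Inl (m + 1, i + 1))) = T (Inr (Suc n, i))"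
      using step by simp
    have "(\<Sum>m=n..L. tri_fwd L T (Inr (m, i)) - tri_fwd L T (Inl (m, i)))
      = tri_fwd L T (Inr (n, i)) - tri_fwd L T (Inl (n, i))
       + (\<Sum>m=Suc n..L. tri_fwd L T (Inr (m, i)) - tri_fwd L T (Inl (m, i)))"
      using step by (intro sum.atLeast_Suc_atMost) simp
    moreover have "(\<Sum>m=n..<L. tri_fwd L T (Inl (m + 1, i + 1)))
      = tri_fwd L T (Inl (Suc n, Suc i)) + (\<Sum>m=Suc n..<L. tri_fwd L T (Inl (m + 1, i + 1)))"
      using step by (subst sum.atLeast_Suc_lessThan) auto
    moreover have "tri_fwd L T (Inr (n, i)) - tri_fwd L T (Inl (n, i)) + tri_fwd L T (Inl (Suc n, Suc i))
       = T (Inr (n, i)) - T (Inr (Suc n, i))"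
      using mem step.hyps by (simp add: tri_fwd_def InlI InrI delta_map_tri)
    ultimately show ?case using IH by linarith
  qed
  show "tri_inv L (tri_fwd L T) j = T j"
  proof (cases "j \<in> tri L <+> tri L")
    case False
    then show ?thesis using assms by (simp add: tri_inv_def extensional_def)
  next
    case True
    then show ?thesis
    proof (cases j)
      case (Inl p)
      then show ?thesis using True by (simp add: tri_inv_def tri_fwd_def)
    next
      case (Inr p)
      obtain k i where p: "p = (k, i)" by (cases p)
      then have "(k, i) \<in> tri L" using True Inr by auto
      then show ?thesis
        unfolding Inr p using V[of k i] by (subst tri_inv_Inr) (simp_all add: tri_def)
    qed
  qed
qed

lemma delta_map_tri_inv:
  assumes "(k, i) \<in> tri L"
  shows "delta_map (tri L <+> tri L) (tri L) (tri_exponent L) (tri_inv L T) (k, i) = T (Inr (k, i))"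
proof (cases "k < L")
  case False
  then have "k = L" using assms by (auto simp: tri_def)
  then show ?thesis using assms by (simp add: delta_map_tri tri_inv_Inl tri_inv_Inr)
next
  case True
  then have mem: "(Suc k, i) \<in> tri L" "(Suc k, Suc i) \<in> tri L" using assms by (auto simp: tri_def)
  have "(\<Sum>m=k..L. T (Inr (m, i)) - T (Inl (m, i)))
      = T (Inr (k, i)) - T (Inl (k, i)) + (\<Sum>m=Suc k..L. T (Inr (m, i)) - T (Inl (m, i)))"
    using True by (intro sum.atLeast_Suc_atMost) simp
  moreover have "(\<Sum>m=k..<L. T (Inl (m + 1, i + 1)))
      = T (Inl (Suc k, Suc i)) + (\<Sum>m=Suc k..<L. T (Inl (m + 1, i + 1)))"
    using True by (subst sum.atLeast_Suc_lessThan) auto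
  ultimately show ?thesis
    using True assms mem by (simp add: delta_map_tri tri_inv_Inl tri_inv_Inr)
qed

lemma measurable_tri_inv [measurable]:
  "tri_inv L \<in> measurable (lebR (tri L <+> tri L)) (lebR (tri L <+> tri L))"
  unfolding tri_inv_def
proof (rule measurable_restrict)
  fix j :: tri_var assume j: "j \<in> tri L <+> tri L"
  show "(\<lambda>T. case j of Inl p \<Rightarrow> T (Inl p) | Inr (k, i) \<Rightarrow>
      (\<Sum>m=k..L. T (Inr (m, i)) - T (Inl (m, i))) + (\<Sum>m=k..<L. T (Inl (m + 1, i + 1))))
    \<in> measurable (lebR (tri L <+> tri L)) lborel"
  proof (cases j)
    case (Inl p)
    then show ?thesis using j by auto
  next
    case (Inr p)
    obtain k i where p: "p = (k, i)" by (cases p)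
    have m1: "Inr (m, i) \<in> tri L <+> tri L" "Inl (m, i) \<in> tri L <+> tri L" if "m \<in> {k..L}" for m
      using that j Inr p by (auto simp: tri_def)
    have m2: "Inl (m + 1, i + 1) \<in> tri L <+> tri L" if "m \<in> {k..<L}" for m
      using that j Inr p by (auto simp: tri_def)
    have "(\<lambda>T. (\<Sum>m=k..L. T (Inr (m, i)) - T (Inl (m, i))) + (\<Sum>m=k..<L. T (Inl (m + 1, i + 1))))
       \<in> borel_measurable (lebR (tri L <+> tri L))"
      using m1 m2
      by (intro borel_measurable_add borel_measurable_sum borel_measurable_diff)
        (auto intro!: measurable_component_singleton[where M = "\<lambda>_. lborel", simplified])
    then show ?thesis by (simp add: Inr p)
  qed
qed

lemma distr_tri_inv:
  "distr (lebR (tri L <+> tri L)) (lebR (tri L <+> tri L)) (tri_inv L) = lebR (tri L <+> tri L)"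
proof -
  define J where "J = tri L <+> tri L"
  define h where "h = (\<lambda>(j :: tri_var) (T :: tri_var \<Rightarrow> real). case j of Inl p \<Rightarrow> 0
     | Inr (k, i) \<Rightarrow> T (Inl (k, i)) - (if k < L then T (Inl (k + 1, i + 1)) + T (Inr (k + 1, i)) else 0))"
  define r where "r = (\<lambda>j :: tri_var. case j of Inl p \<Rightarrow> L + 1 | Inr (k, i) \<Rightarrow> k)"
  have J: "finite J" by (simp add: J_def)
  have memJ: "Inl (k, i) \<in> J" "k < L \<Longrightarrow> Inl (k + 1, i + 1) \<in> J" "k < L \<Longrightarrow> Inr (k + 1, i) \<in> J"
    if "Inr (k, i) \<in> J" for k i
    using that by (auto simp: J_def tri_def)
  have "distr (lebR J) (lebR J) (\<lambda>T. \<lambda>j\<in>J. if j \<in> (Inr ` tri L :: tri_var set) then T j + h j T else T j) = lebR J"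
  proof (rule distr_shear[where r = r])
    fix j assume j: "j \<in> J"
    show "h j \<in> borel_measurable (lebR J)"
    proof (cases j)
      case (Inl p)
      then show ?thesis by (simp add: h_def)
    next
      case (Inr p)
      obtain k i where p: "p = (k, i)" by (cases p)
      note m = memJ[OF j[unfolded Inr p]]
      show ?thesis
      proof (cases "k < L")
        case True
        have "(\<lambda>T. T (Inl (k, i)) - (T (Inl (k + 1, i + 1)) + T (Inr (k + 1, i)))) \<in> borel_measurable (lebR J)"
          using m True by (intro borel_measurable_add borel_measurable_diff)
            (auto intro!: measurable_component_singleton[where M = "\<lambda>_. lborel", simplified])
        then show ?thesis using True by (simp add: h_def Inr p)
      next
        case False
        have "(\<lambda>T. T (Inl (k, i))) \<in> borel_measurable (lebR J)"
          using m by (auto intro!: measurable_component_singleton[where M = "\<lambda>_. lborel", simplified])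
        then show ?thesis using False by (simp add: h_def Inr p)
      qed
    qed
    fix T T' :: "tri_var \<Rightarrow> real" assume eq: "\<And>i. i \<in> J \<Longrightarrow> r j < r i \<Longrightarrow> T i = T' i"
    show "h j T = h j T'"
    proof (cases j)
      case (Inl p)
      then show ?thesis by (simp add: h_def)
    next
      case (Inr p)
      obtain k i where p: "p = (k, i)" by (cases p)
      note m = memJ[OF j[unfolded Inr p]]
      have k: "k \<le> L" using j Inr p by (auto simp: J_def tri_def)
      have e1: "T (Inl (k, i)) = T' (Inl (k, i))"
        using m k by (intro eq) (auto simp: r_def Inr p)
      have "T (Inl (k + 1, i + 1)) = T' (Inl (k + 1, i + 1))" "T (Inr (k + 1, i)) = T' (Inr (k + 1, i))"
        if "k < L"
        using m k that by (auto intro!: eq simp: r_def Inr p simp flip: Suc_eq_plus1)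
      with e1 show ?thesis by (simp add: h_def Inr p)
    qed
  qed (auto simp: J J_def)
  moreover have "(\<lambda>T. \<lambda>j\<in>J. if j \<in> (Inr ` tri L :: tri_var set) then T j + h j T else T j) = tri_fwd L"
    unfolding tri_fwd_def J_def
    by (intro ext restrict_ext) (auto simp: h_def delta_map_tri split: sum.splits)
  ultimately have fwd: "distr (lebR J) (lebR J) (tri_fwd L) = lebR J" by simp
  have mf: "tri_fwd L \<in> measurable (lebR J) (lebR J)"
    unfolding tri_fwd_def J_def
  proof (rule measurable_restrict)
    fix j assume j: "j \<in> tri L <+> tri L"
    show "(\<lambda>T. case j of Inl p \<Rightarrow> T (Inl p)
       | Inr p \<Rightarrow> delta_map (tri L <+> tri L) (tri L) (tri_exponent L) T p)
      \<in> measurable (lebR (tri L <+> tri L)) lborel"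
    proof (cases j)
      case (Inl p)
      then show ?thesis using j by auto
    next
      case (Inr p)
      have "(\<lambda>T. delta_map (tri L <+> tri L) (tri L) (tri_exponent L) T p)
          \<in> measurable (lebR (tri L <+> tri L)) lborel"
        using j Inr
        by (intro measurable_compose[OF measurable_delta_map measurable_component_singleton]) auto
      then show ?thesis by (simp add: Inr)
    qed
  qed
  have mi: "tri_inv L \<in> measurable (lebR J) (lebR J)" unfolding J_def by measurable
  have "distr (lebR J) (lebR J) (tri_inv L) = distr (distr (lebR J) (lebR J) (tri_fwd L)) (lebR J) (tri_inv L)"
    by (simp add: fwd)
  also have "\<dots> = distr (lebR J) (lebR J) (tri_inv L \<circ> tri_fwd L)"
    by (rule distr_distr[OF mi mf])
  also have "\<dots> = distr (lebR J) (lebR J) (\<lambda>T. T)"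
    by (rule distr_cong) (auto simp: tri_inv_fwd J_def space_PiM PiE_def)
  finally show ?thesis by (simp add: distr_id J_def)
qed

definition gg_log ::
  "nat \<Rightarrow> (nat \<Rightarrow> nat \<Rightarrow> complex) \<Rightarrow> (nat \<Rightarrow> nat \<Rightarrow> complex) \<Rightarrow> (tri_var \<Rightarrow> real) \<Rightarrow> complex" where
  "gg_log L \<gamma> \<nu> T = (\<Prod>(k, i)\<in>tri L.
     exp (\<gamma> k i * of_real (T (Inl (k, i))) + \<nu> k i * of_real (T (Inr (k, i)))
          - of_real (exp (T (Inl (k, i))) + exp (T (Inr (k, i))))))"

lemma gg_integrand_exp_point: "gg_integrand L \<gamma> \<nu> (exp_point (tri L <+> tri L) T) = gg_log L \<gamma> \<nu> T"
proof -
  have powr: "complex_of_real (exp t) powr z = exp (z * of_real t)" for t z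
    by (simp add: powr_def Ln_of_real)
  show ?thesis
    unfolding gg_integrand_def gg_log_def Let_def
  proof (intro prod.cong refl, clarify)
    fix k i assume "(k, i) \<in> tri L"
    then have e: "exp_point (tri L <+> tri L) T (Inl (k, i)) = exp (T (Inl (k, i)))"
      "exp_point (tri L <+> tri L) T (Inr (k, i)) = exp (T (Inr (k, i)))"
      by (simp_all add: exp_point_def InlI InrI)
    show "complex_of_real (exp_point (tri L <+> tri L) T (Inl (k, i))) powr \<gamma> k i
        * complex_of_real (exp_point (tri L <+> tri L) T (Inr (k, i))) powr \<nu> k i
        * complex_of_real (exp (- exp_point (tri L <+> tri L) T (Inl (k, i))
            - exp_point (tri L <+> tri L) T (Inr (k, i))))
      = exp (\<gamma> k i * of_real (T (Inl (k, i))) + \<nu> k i * of_real (T (Inr (k, i)))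
          - of_real (exp (T (Inl (k, i))) + exp (T (Inr (k, i)))))"
      unfolding e powr by (simp add: exp_diff exp_add exp_minus field_simps flip: exp_of_real)
  qed
qed

lemma measurable_gg_log [measurable]: "gg_log L \<gamma> \<nu> \<in> borel_measurable (lebR (tri L <+> tri L))"
proof -
  have [measurable]: "(\<lambda>T. T (Inl p)) \<in> borel_measurable (lebR (tri L <+> tri L))"
    "(\<lambda>T. T (Inr p)) \<in> borel_measurable (lebR (tri L <+> tri L))" if "p \<in> tri L" for p
    using that by (auto intro!: measurable_component_singleton[where M = "\<lambda>_. lborel", simplified])
  have "(\<lambda>T. \<Prod>p\<in>tri L.
     exp (\<gamma> (fst p) (snd p) * of_real (T (Inl p)) + \<nu> (fst p) (snd p) * of_real (T (Inr p))
          - of_real (exp (T (Inl p)) + exp (T (Inr p))))) \<in> borel_measurable (lebR (tri L <+> tri L))"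
    by (intro borel_measurable_prod) measurable
  then show ?thesis unfolding gg_log_def by (simp add: case_prod_unfold)
qed

lemma tendsto_gg_log:
  assumes "\<And>j. (\<lambda>n. u n j) \<longlonglongrightarrow> T j"
  shows "(\<lambda>n. gg_log L \<gamma> \<nu> (u n)) \<longlonglongrightarrow> gg_log L \<gamma> \<nu> T"
  unfolding gg_log_def case_prod_unfold by (intro tendsto_intros assms)

lemma tri_lower_bound:
  assumes r: "\<And>p. p \<in> tri L \<Longrightarrow> \<bar>delta_map (tri L <+> tri L) (tri L) (tri_exponent L) T p\<bar> \<le> r"
    and m: "\<And>j. j \<in> tri L <+> tri L \<Longrightarrow> T j \<le> m" and "0 \<le> r" "0 \<le> m"
    and j: "j \<in> tri L <+> tri L"
  shows "\<bar>T j\<bar> \<le> 2 ^ Suc L * (r + m)"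
proof -
  have low: "\<forall>i. 1 \<le> i \<and> i \<le> k \<longrightarrow>
      - (2 ^ (Suc L - k) - 1) * (r + m) \<le> T (Inl (k, i)) \<and> - (2 ^ (Suc L - k) - 1) * (r + m) \<le> T (Inr (k, i))"
    if "k \<le> L" "1 \<le> k" for k
    using that
  proof (induction k rule: inc_induct)
    case base
    show ?case
    proof (intro allI impI)
      fix i assume "1 \<le> i \<and> i \<le> L"
      then have p: "(L, i) \<in> tri L" by (simp add: tri_def)
      show "- (2 ^ (Suc L - L) - 1) * (r + m) \<le> T (Inl (L, i)) \<and> - (2 ^ (Suc L - L) - 1) * (r + m) \<le> T (Inr (L, i))"
        using r[OF p] m[OF InlI[OF p]] m[OF InrI[OF p]] p by (auto simp: delta_map_tri)
    qed
  next
    case (step n)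
    define N :: real where "N = 2 ^ (L - n) - 1"
    have N: "2 ^ (Suc L - n) - 1 = 1 + 2 * N"
      using step.hyps by (simp add: N_def Suc_diff_le less_imp_le)
    show ?case
    proof (intro allI impI)
      fix i assume i: "1 \<le> i \<and> i \<le> n"
      then have p: "(n, i) \<in> tri L" using step.hyps by (simp add: tri_def)
      have "- N * (r + m) \<le> T (Inl (Suc n, Suc i))" "- N * (r + m) \<le> T (Inr (Suc n, i))"
        using step.IH i by (auto simp: N_def)
      then have "- (2 * N) * (r + m) \<le> T (Inl (n + 1, i + 1)) + T (Inr (n + 1, i))"
        by (simp add: algebra_simps)
      moreover have "\<bar>T (Inl (n, i)) + T (Inr (n, i)) - (T (Inl (n + 1, i + 1)) + T (Inr (n + 1, i)))\<bar> \<le> r"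
        using r[OF p] p step.hyps by (simp add: delta_map_tri)
      moreover note m[OF InlI[OF p]] m[OF InrI[OF p]]
      ultimately have "- (r + m) + - (2 * N) * (r + m) \<le> T (Inl (n, i))"
        "- (r + m) + - (2 * N) * (r + m) \<le> T (Inr (n, i))"
        by (simp_all only: abs_le_iff) linarith+
      then show "- (2 ^ (Suc L - n) - 1) * (r + m) \<le> T (Inl (n, i)) \<and> - (2 ^ (Suc L - n) - 1) * (r + m) \<le> T (Inr (n, i))"
        unfolding N by (simp add: algebra_simps)
    qed
  qed
  have "- (2 ^ Suc L * (r + m)) \<le> T j"
  proof -
    obtain k i where ki: "j = Inl (k, i) \<or> j = Inr (k, i)" "(k, i) \<in> tri L"
      using j by auto
    have "(2::real) ^ (Suc L - k) \<le> 2 ^ Suc L" by (intro power_increasing) auto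
    then have "(2 ^ (Suc L - k) - 1) * (r + m) \<le> 2 ^ Suc L * (r + m)"
      using assms by (intro mult_right_mono) auto
    moreover have "- (2 ^ (Suc L - k) - 1) * (r + m) \<le> T j"
      using low[of k] ki by (auto simp: tri_def)
    ultimately show ?thesis by (simp only: mult_minus_left)
  qed
  moreover have "T j \<le> 2 ^ Suc L * (r + m)"
  proof -
    have "T j \<le> 1 * (r + m)" using m[OF j] \<open>0 \<le> r\<close> by simp
    also have "\<dots> \<le> 2 ^ Suc L * (r + m)"
      using \<open>0 \<le> r\<close> \<open>0 \<le> m\<close> by (intro mult_right_mono one_le_power) auto
    finally show ?thesis .
  qed
  ultimately show ?thesis by (simp add: abs_le_iff)
qed

lemma gg_log_bound:
  assumes r: "0 \<le> r"
  obtains C where "\<And>T. (\<And>p. p \<in> tri L \<Longrightarrow> \<bar>delta_map (tri L <+> tri L) (tri L) (tri_exponent L) T p\<bar> \<le> r)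
     \<Longrightarrow> norm (gg_log L \<gamma> \<nu> T) \<le> C * exp (- (\<Sum>j\<in>tri L <+> tri L. \<bar>T j\<bar>))"
proof -
  define J :: "tri_var set" where "J = tri L <+> tri L"
  have J: "finite J" by (simp add: J_def)
  define D where "D = (\<Sum>(k, i)\<in>tri L. \<bar>Re (\<gamma> k i)\<bar> + \<bar>Re (\<nu> k i)\<bar>)"
  have D: "0 \<le> D" unfolding D_def by (intro sum_nonneg) auto
  define K where "K = (D + 1) * (real (card J) * 2 ^ Suc L)"
  have K: "0 \<le> K" using D by (simp add: K_def)
  show ?thesis
  proof (rule that)
    fix T assume T: "\<And>p. p \<in> tri L \<Longrightarrow> \<bar>delta_map (tri L <+> tri L) (tri L) (tri_exponent L) T p\<bar> \<le> r"
    define S where "S = (\<Sum>j\<in>J. \<bar>T j\<bar>)"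
    define m where "m = Max (insert 0 (T ` J))"
    have m0: "0 \<le> m" and mj: "\<And>j. j \<in> J \<Longrightarrow> T j \<le> m" using J by (auto simp: m_def)
    have "S \<le> (\<Sum>j\<in>J. 2 ^ Suc L * (r + m))"
      unfolding S_def
      by (intro sum_mono tri_lower_bound[OF T _ r m0]) (use mj in \<open>auto simp: J_def\<close>)
    then have S: "S \<le> real (card J) * 2 ^ Suc L * (r + m)" by simp
    have W: "exp m - 1 \<le> (\<Sum>j\<in>J. exp (T j))"
    proof -
      have "m \<in> insert 0 (T ` J)" unfolding m_def using J by (intro Max_in) auto
      then consider "m = 0" | j where "j \<in> J" "m = T j" by auto
      then show ?thesis
      proof cases
        case 1
        then show ?thesis by (simp add: sum_nonneg)
      next
        case 2
        then have "exp (T j) \<le> (\<Sum>j\<in>J. exp (T j))"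
          using J by (intro member_le_sum) auto
        then show ?thesis using 2 by simp
      qed
    qed
    have "norm (gg_log L \<gamma> \<nu> T) = (\<Prod>p\<in>tri L.
        exp (Re (\<gamma> (fst p) (snd p)) * T (Inl p) + Re (\<nu> (fst p) (snd p)) * T (Inr p) - (exp (T (Inl p)) + exp (T (Inr p)))))"
      unfolding gg_log_def by (simp add: prod_norm[symmetric] case_prod_unfold)
    also have "\<dots> = exp (\<Sum>p\<in>tri L.
        Re (\<gamma> (fst p) (snd p)) * T (Inl p) + Re (\<nu> (fst p) (snd p)) * T (Inr p) - (exp (T (Inl p)) + exp (T (Inr p))))"
      by (simp add: exp_sum)
    also have "\<dots> \<le> exp (D * S - (\<Sum>j\<in>J. exp (T j)))"
    proof -
      have memS: "\<bar>T j\<bar> \<le> S" if "j \<in> J" for j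
        unfolding S_def using J that by (intro member_le_sum) auto
      have "(\<Sum>p\<in>tri L. Re (\<gamma> (fst p) (snd p)) * T (Inl p) + Re (\<nu> (fst p) (snd p)) * T (Inr p))
         \<le> (\<Sum>p\<in>tri L. (\<bar>Re (\<gamma> (fst p) (snd p))\<bar> + \<bar>Re (\<nu> (fst p) (snd p))\<bar>) * S)"
      proof (rule sum_mono)
        fix p assume p: "p \<in> tri L"
        have le: "a * T j \<le> \<bar>a\<bar> * S" if "j \<in> J" for a j
        proof -
          have "a * T j \<le> \<bar>a\<bar> * \<bar>T j\<bar>" by (simp add: abs_mult[symmetric])
          also have "\<dots> \<le> \<bar>a\<bar> * S" using memS[OF that] by (intro mult_left_mono) auto
          finally show ?thesis .
        qed
        show "Re (\<gamma> (fst p) (snd p)) * T (Inl p) + Re (\<nu> (fst p) (snd p)) * T (Inr p)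
          \<le> (\<bar>Re (\<gamma> (fst p) (snd p))\<bar> + \<bar>Re (\<nu> (fst p) (snd p))\<bar>) * S"
          using le[of "Inl p" "Re (\<gamma> (fst p) (snd p))"] le[of "Inr p" "Re (\<nu> (fst p) (snd p))"] p
          by (simp add: J_def InlI InrI distrib_right)
      qed
      also have "\<dots> = D * S" by (simp add: D_def case_prod_unfold sum_distrib_right)
      finally show ?thesis
        by (simp add: sum_subtractf J_def sum.Plus sum.distrib)
    qed
    also have "\<dots> \<le> exp (K * r + K\<^sup>2 / 2 + 1 - S)"
    proof -
      have "(D + 1) * S \<le> K * (r + m)"
        using mult_left_mono[OF S, of "D + 1"] D by (simp add: K_def mult_ac)
      moreover have "K * m - exp m \<le> K\<^sup>2 / 2"
      proof -
        have "1 + m + m\<^sup>2 / 2 \<le> exp m" using m0 by (rule exp_lower_Taylor_quadratic)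
        moreover have "0 \<le> (K - m)\<^sup>2" by simp
        ultimately show ?thesis using m0 by (simp add: power2_eq_square algebra_simps)
      qed
      ultimately show ?thesis using W by (simp add: algebra_simps)
    qed
    also have "\<dots> = exp (K * r + K\<^sup>2 / 2 + 1) * exp (- S)" by (simp flip: exp_add)
    finally show "norm (gg_log L \<gamma> \<nu> T)
        \<le> exp (K * r + K\<^sup>2 / 2 + 1) * exp (- (\<Sum>j\<in>tri L <+> tri L. \<bar>T j\<bar>))"
      by (simp add: S_def J_def)
  qed
qed

definition gg_density ::
  "nat \<Rightarrow> (nat \<Rightarrow> nat \<Rightarrow> complex) \<Rightarrow> (nat \<Rightarrow> nat \<Rightarrow> complex) \<Rightarrow> (nat \<times> nat \<Rightarrow> real) \<Rightarrow> complex" where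
  "gg_density L \<gamma> \<nu> s =
     (LINT u|lebR (tri L). gg_log L \<gamma> \<nu> (tri_inv L (sum_point (tri L) (tri L) (u, s))))"

lemma gg_log_tri_inv_bound:
  assumes r: "0 \<le> r"
  obtains C where "0 \<le> C" "\<And>T. (\<And>p. p \<in> tri L \<Longrightarrow> \<bar>T (Inr p)\<bar> \<le> r)
     \<Longrightarrow> norm (gg_log L \<gamma> \<nu> (tri_inv L T)) \<le> C * (\<Prod>p\<in>tri L. exp (- \<bar>T (Inl p)\<bar>))"
proof -
  obtain C where C: "\<And>T. (\<And>p. p \<in> tri L \<Longrightarrow> \<bar>delta_map (tri L <+> tri L) (tri L) (tri_exponent L) T p\<bar> \<le> r)
     \<Longrightarrow> norm (gg_log L \<gamma> \<nu> T) \<le> C * exp (- (\<Sum>j\<in>tri L <+> tri L. \<bar>T j\<bar>))"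
    using gg_log_bound[OF r] by blast
  show ?thesis
  proof (rule that)
    show "0 \<le> \<bar>C\<bar>" by simp
    fix T :: "tri_var \<Rightarrow> real" assume T: "\<And>p. p \<in> tri L \<Longrightarrow> \<bar>T (Inr p)\<bar> \<le> r"
    have "norm (gg_log L \<gamma> \<nu> (tri_inv L T))
        \<le> C * exp (- (\<Sum>j\<in>tri L <+> tri L. \<bar>tri_inv L T j\<bar>))"
    proof (rule C)
      fix p assume "p \<in> tri L"
      then show "\<bar>delta_map (tri L <+> tri L) (tri L) (tri_exponent L) (tri_inv L T) p\<bar> \<le> r"
        using T by (cases p) (simp add: delta_map_tri_inv)
    qed
    also have "\<dots> \<le> \<bar>C\<bar> * exp (- (\<Sum>p\<in>tri L. \<bar>T (Inl p)\<bar>))"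
    proof (rule mult_mono)
      have "(\<Sum>p\<in>tri L. \<bar>T (Inl p)\<bar>) = (\<Sum>p\<in>tri L. \<bar>tri_inv L T (Inl p)\<bar>)"
        by (intro sum.cong) (auto simp: tri_inv_Inl)
      also have "\<dots> \<le> (\<Sum>j\<in>tri L <+> tri L. \<bar>tri_inv L T j\<bar>)"
        by (simp add: sum.Plus sum_nonneg)
      finally show "exp (- (\<Sum>j\<in>tri L <+> tri L. \<bar>tri_inv L T j\<bar>)) \<le> exp (- (\<Sum>p\<in>tri L. \<bar>T (Inl p)\<bar>))"
        by simp
    qed auto
    also have "\<dots> = \<bar>C\<bar> * (\<Prod>p\<in>tri L. exp (- \<bar>T (Inl p)\<bar>))"
      by (simp add: exp_sum[symmetric] sum_negf)
    finally show "norm (gg_log L \<gamma> \<nu> (tri_inv L T)) \<le> \<bar>C\<bar> * (\<Prod>p\<in>tri L. exp (- \<bar>T (Inl p)\<bar>))" .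
  qed
qed

lemma sum_point_Inl: "p \<in> A \<Longrightarrow> sum_point A B (u, v) (Inl p) = u p"
  and sum_point_Inr: "q \<in> B \<Longrightarrow> sum_point A B (u, v) (Inr q) = v q"
  by (auto simp: sum_point_def)

lemma continuous_gg_density: "continuous_on (\<Pi>\<^sub>E p\<in>tri L. UNIV) (gg_density L \<gamma> \<nu>)"
proof (rule continuous_on_sequentiallyI)
  interpret product_sigma_finite "\<lambda>_::nat \<times> nat. lborel :: real measure"
    by (rule product_sigma_finite_lborel)
  fix s :: "nat \<Rightarrow> nat \<times> nat \<Rightarrow> real" and a
  assume s: "\<forall>n. s n \<in> (\<Pi>\<^sub>E p\<in>tri L. UNIV)" and a: "a \<in> (\<Pi>\<^sub>E p\<in>tri L. UNIV)" and "s \<longlonglongrightarrow> a"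
  then have lim: "\<And>p. (\<lambda>n. s n p) \<longlonglongrightarrow> a p" unfolding tendsto_fun_iff by blast
  have "\<exists>r. \<forall>n. \<bar>s n p\<bar> \<le> r" for p
    using convergent_imp_Bseq[OF convergentI[OF lim[of p]]] by (auto simp: Bseq_def)
  then obtain b where b: "\<And>p n. \<bar>s n p\<bar> \<le> b p" by metis
  have b0: "0 \<le> b p" for p using b[where n=0 and p=p] by linarith
  define r where "r = (\<Sum>p\<in>tri L. b p)"
  have r0: "0 \<le> r" unfolding r_def by (intro sum_nonneg b0)
  have r: "\<bar>s n p\<bar> \<le> r" if "p \<in> tri L" for n p
  proof -
    have "b p \<le> r" unfolding r_def using that b0 by (intro member_le_sum) auto
    then show ?thesis using b[of n p] by linarith
  qed
  obtain C where C: "0 \<le> C" "\<And>T. (\<And>p. p \<in> tri L \<Longrightarrow> \<bar>T (Inr p)\<bar> \<le> r)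
     \<Longrightarrow> norm (gg_log L \<gamma> \<nu> (tri_inv L T)) \<le> C * (\<Prod>p\<in>tri L. exp (- \<bar>T (Inl p)\<bar>))"
    using gg_log_tri_inv_bound[OF r0] by blast
  have meas: "(\<lambda>u. gg_log L \<gamma> \<nu> (tri_inv L (sum_point (tri L) (tri L) (u, x)))) \<in> borel_measurable (lebR (tri L))"
    if "x \<in> (\<Pi>\<^sub>E p\<in>tri L. UNIV)" for x
  proof -
    have "x \<in> space (lebR (tri L))" using that by (simp add: space_PiM)
    then have "(\<lambda>u. sum_point (tri L) (tri L) (u, x)) \<in> measurable (lebR (tri L)) (lebR (tri L <+> tri L))"
      by measurable
    from measurable_compose[OF measurable_compose[OF this measurable_tri_inv] measurable_gg_log]
    show ?thesis .
  qed
  show "(\<lambda>n. gg_density L \<gamma> \<nu> (s n)) \<longlonglongrightarrow> gg_density L \<gamma> \<nu> a"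
    unfolding gg_density_def
  proof (rule integral_dominated_convergence)
    show "integrable (lebR (tri L)) (\<lambda>u. C * (\<Prod>p\<in>tri L. exp (- \<bar>u p\<bar>)))"
      by (intro integrable_mult_right product_integrable_prod) (auto intro: integrable_exp_neg_abs)
    show "AE u in lebR (tri L). norm (gg_log L \<gamma> \<nu> (tri_inv L (sum_point (tri L) (tri L) (u, s n))))
        \<le> C * (\<Prod>p\<in>tri L. exp (- \<bar>u p\<bar>))" for n
    proof (rule AE_I2)
      fix u
      have "norm (gg_log L \<gamma> \<nu> (tri_inv L (sum_point (tri L) (tri L) (u, s n))))
        \<le> C * (\<Prod>p\<in>tri L. exp (- \<bar>sum_point (tri L) (tri L) (u, s n) (Inl p)\<bar>))"
        by (rule C(2)) (simp add: sum_point_Inr r)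
      then show "norm (gg_log L \<gamma> \<nu> (tri_inv L (sum_point (tri L) (tri L) (u, s n))))
        \<le> C * (\<Prod>p\<in>tri L. exp (- \<bar>u p\<bar>))"
        by (simp add: sum_point_Inl)
    qed
    show "AE u in lebR (tri L). (\<lambda>n. gg_log L \<gamma> \<nu> (tri_inv L (sum_point (tri L) (tri L) (u, s n))))
        \<longlonglongrightarrow> gg_log L \<gamma> \<nu> (tri_inv L (sum_point (tri L) (tri L) (u, a)))"
    proof (rule AE_I2, rule tendsto_gg_log)
      fix u and j :: tri_var
      have sp: "(\<lambda>n. sum_point (tri L) (tri L) (u, s n) j) \<longlonglongrightarrow> sum_point (tri L) (tri L) (u, a) j" for j
        by (cases j) (auto simp: sum_point_def restrict_def intro: lim)
      show "(\<lambda>n. tri_inv L (sum_point (tri L) (tri L) (u, s n)) j)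
          \<longlonglongrightarrow> tri_inv L (sum_point (tri L) (tri L) (u, a)) j"
        unfolding tri_inv_def restrict_def
        by (cases j) (auto split: prod.splits intro!: tendsto_intros sp)
    qed
  qed (use s a meas in auto)
qed

lemma is_delta_density_gg:
  "is_delta_density (tri L <+> tri L) (tri L) (tri_exponent L) (gg_integrand L \<gamma> \<nu>) (gg_density L \<gamma> \<nu>)"
  unfolding is_delta_density_def
proof (intro conjI ballI impI)
  show "continuous_on (\<Pi>\<^sub>E p\<in>tri L. UNIV) (gg_density L \<gamma> \<nu>)" by (rule continuous_gg_density)
next
  define I where "I = tri L"
  define J :: "tri_var set" where "J = tri L <+> tri L"
  define \<delta> where "\<delta> = delta_map J I (tri_exponent L)"
  fix E assume E: "E \<in> sets (lebR (tri L))" and "\<exists>r. E \<subseteq> (\<Pi>\<^sub>E \<alpha>\<in>tri L. {-r..r})"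
  then obtain r0 where "E \<subseteq> (\<Pi>\<^sub>E \<alpha>\<in>tri L. {-r0..r0})" by blast
  then have Er0: "\<bar>s p\<bar> \<le> r0" if "s \<in> E" "p \<in> tri L" for s p
    using that by (force simp: PiE_iff abs_le_iff)
  define r where "r = max 0 r0"
  have r: "0 \<le> r" and Er: "\<And>s p. s \<in> E \<Longrightarrow> p \<in> tri L \<Longrightarrow> \<bar>s p\<bar> \<le> r"
    using Er0 by (auto simp: r_def intro: le_max_iff_disj[THEN iffD2])
  note [measurable] = E
  interpret PI: product_sigma_finite "\<lambda>_::nat \<times> nat. lborel :: real measure"
    by (rule product_sigma_finite_lborel)
  interpret PJ: product_sigma_finite "\<lambda>_::tri_var. lborel :: real measure"
    by (rule product_sigma_finite_lborel)
  interpret FI: finite_product_sigma_finite "\<lambda>_::nat \<times> nat. lborel :: real measure" "tri L"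
    by standard simp
  interpret P: pair_sigma_finite "lebR (tri L)" "lebR (tri L)" ..
  define f where "f = (\<lambda>T. indicator E (\<delta> T) *\<^sub>R gg_log L \<gamma> \<nu> T)"
  have m\<delta>[measurable]: "\<delta> \<in> measurable (lebR J) (lebR (tri L))" unfolding \<delta>_def I_def by measurable
  have mg[measurable]: "gg_log L \<gamma> \<nu> \<in> borel_measurable (lebR J)" unfolding J_def by measurable
  have mi[measurable]: "tri_inv L \<in> measurable (lebR J) (lebR J)" unfolding J_def by measurable
  have mp[measurable]: "sum_point (tri L) (tri L) \<in> measurable (lebR (tri L) \<Otimes>\<^sub>M lebR (tri L)) (lebR J)"
    unfolding J_def by measurable
  have mf[measurable]: "f \<in> borel_measurable (lebR J)" unfolding f_def by measurable
  have di: "distr (lebR J) (lebR J) (tri_inv L) = lebR J" unfolding J_def by (rule distr_tri_inv)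
  have ds: "distr (lebR (tri L) \<Otimes>\<^sub>M lebR (tri L)) (lebR J) (sum_point (tri L) (tri L)) = lebR J"
    unfolding J_def by (rule distr_sum_point) auto
  have \<delta>_inv: "\<delta> (tri_inv L T) = (\<lambda>p\<in>tri L. T (Inr p))" for T
  proof
    fix p show "\<delta> (tri_inv L T) p = (\<lambda>p\<in>tri L. T (Inr p)) p"
    proof (cases "p \<in> tri L")
      case True
      then show ?thesis by (cases p) (simp add: \<delta>_def I_def J_def delta_map_tri_inv)
    next
      case False
      then show ?thesis by (simp add: \<delta>_def I_def delta_map_def)
    qed
  qed
  obtain C where C: "0 \<le> C" "\<And>T. (\<And>p. p \<in> tri L \<Longrightarrow> \<bar>T (Inr p)\<bar> \<le> r)
     \<Longrightarrow> norm (gg_log L \<gamma> \<nu> (tri_inv L T)) \<le> C * (\<Prod>p\<in>tri L. exp (- \<bar>T (Inl p)\<bar>))"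
    using gg_log_tri_inv_bound[OF r] by blast
  define w :: "tri_var \<Rightarrow> real \<Rightarrow> real"
    where "w = (\<lambda>j x. case j of Inl p \<Rightarrow> exp (- \<bar>x\<bar>) | Inr p \<Rightarrow> indicator {-r..r} x)"
  have wint: "integrable (lebR J) (\<lambda>T. C * (\<Prod>j\<in>J. w j (T j)))"
  proof (intro integrable_mult_right PJ.product_integrable_prod)
    show "finite J" by (simp add: J_def)
    fix j
    show "integrable lborel (w j)"
    proof (cases j)
      case (Inl p)
      then show ?thesis by (simp add: w_def integrable_exp_neg_abs)
    next
      case (Inr p)
      have "integrable lborel (indicator {-r..r} :: real \<Rightarrow> real)"
        using r by (intro integrable_real_indicator) auto
      then show ?thesis by (simp add: w_def Inr)
    qed
  qed
  have fint': "integrable (lebR J) (\<lambda>T. f (tri_inv L T))"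
  proof (rule Bochner_Integration.integrable_bound[OF wint])
    show "AE T in lebR J. norm (f (tri_inv L T)) \<le> norm (C * (\<Prod>j\<in>J. w j (T j)))"
    proof (rule AE_I2)
      fix T
      have w0: "0 \<le> C * (\<Prod>j\<in>J. w j (T j))"
        using C(1) by (intro mult_nonneg_nonneg prod_nonneg) (auto simp: w_def split: sum.splits)
      show "norm (f (tri_inv L T)) \<le> norm (C * (\<Prod>j\<in>J. w j (T j)))"
      proof (cases "(\<lambda>p\<in>tri L. T (Inr p)) \<in> E")
        case False
        then show ?thesis by (simp add: f_def \<delta>_inv)
      next
        case True
        have T: "\<bar>T (Inr p)\<bar> \<le> r" if "p \<in> tri L" for p
          using Er[OF True that] that by simp
        have "(\<Prod>j\<in>J. w j (T j)) = (\<Prod>p\<in>tri L. exp (- \<bar>T (Inl p)\<bar>)) * (\<Prod>p\<in>tri L. indicator {-r..r} (T (Inr p)))"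
          by (simp add: J_def prod.Plus w_def)
        also have "(\<Prod>p\<in>tri L. indicator {-r..r} (T (Inr p))) = (1::real)"
        proof (intro prod.neutral ballI)
          fix p assume "p \<in> tri L"
          from T[OF this] show "indicator {-r..r} (T (Inr p)) = (1::real)"
            by (simp add: indicator_def abs_le_iff)
        qed
        finally have eq: "(\<Prod>j\<in>J. w j (T j)) = (\<Prod>p\<in>tri L. exp (- \<bar>T (Inl p)\<bar>))" by simp
        have "norm (f (tri_inv L T)) = norm (gg_log L \<gamma> \<nu> (tri_inv L T))"
          using True by (simp add: f_def \<delta>_inv)
        also have "\<dots> \<le> C * (\<Prod>j\<in>J. w j (T j))"
          unfolding eq using T by (rule C(2))
        finally show ?thesis using w0 by simp
      qed
    qed
  qed measurable
  have fint: "integrable (lebR J) f"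
    using integrable_distr_eq[OF mi mf] fint' by (simp add: di)
  have pint: "integrable (lebR (tri L) \<Otimes>\<^sub>M lebR (tri L)) (\<lambda>x. f (tri_inv L (sum_point (tri L) (tri L) x)))"
    using integrable_distr_eq[OF mp, of "\<lambda>T. f (tri_inv L T)"] fint' by (simp add: ds)
  have eq: "f T = indicator {T. delta_map (tri L <+> tri L) (tri L) (tri_exponent L) T \<in> E} T *\<^sub>R
      gg_integrand L \<gamma> \<nu> (exp_point (tri L <+> tri L) T)" for T
    by (simp add: f_def gg_integrand_exp_point \<delta>_def I_def J_def indicator_def)
  show "set_integrable (lebR (tri L <+> tri L))
      {T. delta_map (tri L <+> tri L) (tri L) (tri_exponent L) T \<in> E}
      (\<lambda>T. gg_integrand L \<gamma> \<nu> (exp_point (tri L <+> tri L) T))"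
    unfolding set_integrable_def eq[symmetric] using fint by (simp add: J_def)
  have "(LINT T:{T. delta_map (tri L <+> tri L) (tri L) (tri_exponent L) T \<in> E}|lebR (tri L <+> tri L).
         gg_integrand L \<gamma> \<nu> (exp_point (tri L <+> tri L) T)) = integral\<^sup>L (lebR J) f"
    unfolding set_lebesgue_integral_def eq[symmetric] by (simp add: J_def)
  also have "\<dots> = integral\<^sup>L (lebR J) (\<lambda>T. f (tri_inv L T))"
    by (subst di[symmetric], subst integral_distr) auto
  also have "\<dots> = integral\<^sup>L (lebR (tri L) \<Otimes>\<^sub>M lebR (tri L)) (\<lambda>x. f (tri_inv L (sum_point (tri L) (tri L) x)))"
    by (subst ds[symmetric], subst integral_distr) auto
  also have "\<dots> = (LINT s|lebR (tri L). LINT u|lebR (tri L). f (tri_inv L (sum_point (tri L) (tri L) (u, s))))"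
    using P.integral_snd[of "\<lambda>u s. f (tri_inv L (sum_point (tri L) (tri L) (u, s)))"] pint
    by (simp add: case_prod_unfold)
  also have "\<dots> = (LINT s:E|lebR (tri L). gg_density L \<gamma> \<nu> s)"
    unfolding set_lebesgue_integral_def
  proof (rule Bochner_Integration.integral_cong)
    fix s assume "s \<in> space (lebR (tri L))"
    then have "(\<lambda>p\<in>tri L. sum_point (tri L) (tri L) (u, s) (Inr p)) = s" for u
      by (auto simp: space_PiM PiE_def extensional_def sum_point_Inr fun_eq_iff)
    then show "(LINT u|lebR (tri L). f (tri_inv L (sum_point (tri L) (tri L) (u, s))))
       = indicator E s *\<^sub>R gg_density L \<gamma> \<nu> s"
      by (simp add: f_def \<delta>_inv gg_density_def)
  qed simp
  finally show "(LINT T:{T. delta_map (tri L <+> tri L) (tri L) (tri_exponent L) T \<in> E}|lebR (tri L <+> tri L).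
         gg_integrand L \<gamma> \<nu> (exp_point (tri L <+> tri L) T)) = (LINT s:E|lebR (tri L). gg_density L \<gamma> \<nu> s)" .
qed

lemma tri_exponent_linearly_independent:
  assumes "\<And>j. j \<in> tri L <+> tri L \<Longrightarrow> (\<Sum>\<alpha>\<in>tri L. u \<alpha> * of_int (tri_exponent L \<alpha> j)) = (0::real)"
    and \<beta>: "\<beta> \<in> tri L"
  shows "u \<beta> = 0"
proof -
  define T where "T = tri_inv L (\<lambda>j. if j = Inr \<beta> then 1 else 0)"
  have "u \<beta> = (\<Sum>\<alpha>\<in>tri L. if \<alpha> = \<beta> then u \<alpha> else 0)"
    using \<beta> by simp
  also have "\<dots> = (\<Sum>\<alpha>\<in>tri L. u \<alpha> * delta_map (tri L <+> tri L) (tri L) (tri_exponent L) T \<alpha>)"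
  proof (rule sum.cong[OF refl])
    fix \<alpha> assume "\<alpha> \<in> tri L"
    then show "(if \<alpha> = \<beta> then u \<alpha> else 0)
        = u \<alpha> * delta_map (tri L <+> tri L) (tri L) (tri_exponent L) T \<alpha>"
      by (cases \<alpha>) (auto simp: T_def delta_map_tri_inv)
  qed
  also have "\<dots> = (\<Sum>\<alpha>\<in>tri L. \<Sum>j\<in>tri L <+> tri L. u \<alpha> * of_int (tri_exponent L \<alpha> j) * T j)"
    by (simp add: delta_map_def sum_distrib_left mult.assoc)
  also have "\<dots> = (\<Sum>j\<in>tri L <+> tri L. (\<Sum>\<alpha>\<in>tri L. u \<alpha> * of_int (tri_exponent L \<alpha> j)) * T j)"
    by (subst sum.swap) (simp add: sum_distrib_right)
  also have "\<dots> = 0" using assms(1) by (simp)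
  finally show ?thesis .
qed

lemma gg_hyper_eq:
  "gg_hyper L \<gamma> \<nu> y z = gg_density L \<gamma> \<nu> (\<lambda>p\<in>tri L. - ln (gg_delta L y z p))"
  unfolding gg_hyper_def by (rule delta_integral_eqI[OF finite_tri is_delta_density_gg])

lemma is_delta_density_cong:
  assumes "\<And>T. F (exp_point J T) = G (exp_point J T)"
  shows "is_delta_density J A l F g \<longleftrightarrow> is_delta_density J A l G g"
  unfolding is_delta_density_def assms ..

lemma whittaker_density_exists:
  "\<exists>g. is_delta_density (tri L <+> tri L) (tri L) (tri_exponent L) (whittaker_integrand L lam) g"
proof -
  have "whittaker_integrand L lam (exp_point (tri L <+> tri L) T)
      = gg_integrand L (special_gamma lam) (special_nu lam) (exp_point (tri L <+> tri L) T)" for T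
  proof -
    define t where "t = exp_point (tri L <+> tri L) T"
    have nz: "t (Inr p) \<noteq> 0" if "p \<in> tri L" for p
      using that by (simp add: t_def exp_point_def InrI)
    have "(\<Prod>p\<in>tri L. complex_of_real (t (Inr p)) powr special_nu lam (fst p) (snd p))
        = (\<Prod>p\<in>(\<lambda>k. (k, k)) ` {1..L}. complex_of_real (t (Inr p)) powr special_nu lam (fst p) (snd p))"
    proof (rule prod.mono_neutral_right)
      show "(\<lambda>k. (k, k)) ` {1..L} \<subseteq> tri L" by (auto simp: tri_def)
      show "\<forall>p\<in>tri L - (\<lambda>k. (k, k)) ` {1..L}.
          complex_of_real (t (Inr p)) powr special_nu lam (fst p) (snd p) = 1"
        using nz by (auto simp: special_nu_def tri_def image_iff)
    qed simp
    also have "\<dots> = (\<Prod>k=1..L. complex_of_real (t (Inr (k, k))) powr (\<Sum>i=1..k. lam i))"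
      by (subst prod.reindex) (auto simp: inj_on_def special_nu_def)
    finally have b: "(\<Prod>k=1..L. complex_of_real (t (Inr (k, k))) powr (\<Sum>i=1..k. lam i))
        = (\<Prod>p\<in>tri L. complex_of_real (t (Inr p)) powr special_nu lam (fst p) (snd p))" ..
    show ?thesis
      unfolding t_def[symmetric] whittaker_integrand_def gg_integrand_def Let_def b
      by (simp add: prod.distrib special_gamma_def case_prod_unfold mult_ac)
  qed
  then have "is_delta_density (tri L <+> tri L) (tri L) (tri_exponent L) (whittaker_integrand L lam) g
     \<longleftrightarrow> is_delta_density (tri L <+> tri L) (tri L) (tri_exponent L)
           (gg_integrand L (special_gamma lam) (special_nu lam)) g" for g
    by (rule is_delta_density_cong)
  then show ?thesis using is_delta_density_gg by blast
qed

lemma res_point_exists: "\<exists>y z. res_point L x y z"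
proof (intro exI)
  show "res_point L x (\<lambda>k i. x (i + L - k) - x (i + L - k + 1)) (\<lambda>_ _. 0)"
    by (simp add: res_point_def gg_R_def gg_B_def)
qed

lemma res_gg_hyper_eq:
  assumes "res_point L x y z"
  shows "res_gg_hyper L \<gamma> \<nu> x = gg_hyper L \<gamma> \<nu> y z"
  unfolding res_gg_hyper_def
proof (rule the_equality)
  have ln_delta: "(\<lambda>p\<in>tri L. - ln (gg_delta L y z p)) = (\<lambda>(k, i)\<in>tri L. if k = L then x i - x (i + 1) else 0)"
    if "res_point L x y z" for y z
    using that
    by (intro restrict_ext)
      (auto simp: res_point_def gg_R_def gg_B_def gg_delta_def tri_def add.commute order_le_less
          split: prod.splits)
  fix v assume "\<exists>y z. res_point L x y z \<and> v = gg_hyper L \<gamma> \<nu> y z"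
  then show "v = gg_hyper L \<gamma> \<nu> y z"
    using ln_delta assms by (auto simp: gg_hyper_eq)
qed (use assms in blast)

end

theory Submission
  imports Defs
begin

text \<open>
  Once the overall exponential factor of the Whittaker function cancels, both sides are
  delta-integrals over the same variables with the same exponent vectors, and they agree because
  their remaining data agree: at the special spectral values the two integrands coincide at positive
  arguments (\<open>whittaker_integrand_eq_gg_integrand\<close>), and at a restriction point the two families of
  delta-constants coincide (\<open>gg_delta_eq_whittaker_delta\<close>).  A delta-integral depends on its data
  only in this way (\<open>delta_integral_cong\<close>).  The restricted function is its value at one restriction
  point, which is legitimate by \<open>res_gg_hyper_eq\<close>; that lemma rests on the existence and uniqueness
  of the continuous density.
\<close>

text \<open>
  The integrand enters only through its values at exponentials, hence at positive points, and the
  constants only through their values at the indices of the delta-factors.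
\<close>

lemma delta_integral_cong:
  assumes F: "\<And>T. F (exp_point J T) = G (exp_point J T)"
    and c: "\<And>\<alpha>. \<alpha> \<in> A \<Longrightarrow> c \<alpha> = d \<alpha>"
  shows "delta_integral J A l c F = delta_integral J A l d G"
proof -
  have "(\<lambda>\<alpha>\<in>A. - ln (c \<alpha>)) = (\<lambda>\<alpha>\<in>A. - ln (d \<alpha>))"
    by (rule restrict_ext) (simp add: c)
  moreover have "is_delta_density J A l F g \<longleftrightarrow> is_delta_density J A l G g" for g
    by (rule is_delta_density_cong) (rule F)
  ultimately show ?thesis
    by (simp add: delta_integral_def)
qed

text \<open>
  Row \<open>k\<close> of the hypergeometric integrand contains \<open>\<Prod>\<^sub>i b\<^bsub>k,i\<^esub> powr \<nu>\<^bsub>k,i\<^esub>\<close>; for the special \<open>\<nu>\<close>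
  only the diagonal factor \<open>i = k\<close> survives.  Nonvanishing of the \<open>b\<^bsub>k,i\<^esub>\<close> matters because
  \<open>0 powr 0 = 0\<close>.
\<close>

lemma whittaker_integrand_eq_gg_integrand:
  assumes "\<And>p. p \<in> tri L \<Longrightarrow> t (Inr p) \<noteq> 0"
  shows "whittaker_integrand L lam t = gg_integrand L (special_gamma lam) (special_nu lam) t"
proof -
  have tri: "tri L = (SIGMA k:{1..L}. {1..k})"
    by (auto simp: tri_def)
  have row: "(\<Prod>i=1..k. complex_of_real (t (Inr (k, i))) powr special_nu lam k i)
      = complex_of_real (t (Inr (k, k))) powr (\<Sum>i=1..k. lam i)" if k: "k \<in> {1..L}" for k
  proof -
    have "(\<Prod>i=1..k. complex_of_real (t (Inr (k, i))) powr special_nu lam k i)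
        = (\<Prod>i=1..k. if i = k then complex_of_real (t (Inr (k, k))) powr (\<Sum>j=1..k. lam j) else 1)"
      using k assms by (intro prod.cong refl) (auto simp: special_nu_def tri)
    also have "\<dots> = complex_of_real (t (Inr (k, k))) powr (\<Sum>i=1..k. lam i)"
      using k by simp
    finally show ?thesis .
  qed
  have "(\<Prod>(k, i)\<in>tri L. complex_of_real (t (Inr (k, i))) powr special_nu lam k i)
      = (\<Prod>k=1..L. complex_of_real (t (Inr (k, k))) powr (\<Sum>i=1..k. lam i))"
    unfolding tri prod.Sigma[OF finite_atLeastAtMost ballI[OF finite_atLeastAtMost], symmetric]
    by (rule prod.cong[OF refl row])
  then show ?thesis
    by (simp add: whittaker_integrand_def gg_integrand_def Let_def special_gamma_def
        case_prod_unfold prod.distrib mult_ac)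
qed

lemma gg_delta_eq_whittaker_delta:
  assumes "res_point L x y z" "p \<in> tri L"
  shows "gg_delta L y z p = whittaker_delta L x p"
proof (cases p)
  case (Pair k i)
  have R: "y L i + z L i = x i - x (i + 1)" if "k = L"
    using assms that by (simp add: Pair tri_def res_point_def gg_R_def)
  have B: "y k i + z k i - y (k + 1) (i + 1) - z (k + 1) i = 0" if "k \<noteq> L"
    using assms that by (simp add: Pair tri_def res_point_def gg_B_def)
  show ?thesis
  proof (cases "k = L")
    case True
    then have "- y L i - z L i = - x i + x (i + 1)"
      using R by linarith
    then show ?thesis
      using True by (simp add: Pair gg_delta_def whittaker_delta_def)
  next
    case False
    then have "- y k i - z k i + y (k + 1) (i + 1) + z (k + 1) i = 0"
      using B by linarith
    then show ?thesis
      using False by (simp add: Pair gg_delta_def whittaker_delta_def)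
  qed
qed

theorem lemma5p1:
  fixes L :: nat and lam :: "nat \<Rightarrow> complex" and x :: "nat \<Rightarrow> real"
  assumes "L \<ge> 1"
    and "\<forall>i\<in>{1..L+1}. Re (lam i) > 0"
  shows "res_gg_hyper L (special_gamma lam) (special_nu lam) x
           = exp (- complex_of_real (x (L + 1)) * (\<Sum>i=1..L+1. lam i)) * whittaker L lam x"
proof -
  obtain y z where yz: "res_point L x y z"
    using res_point_exists by blast
  have "res_gg_hyper L (special_gamma lam) (special_nu lam) x
      = gg_hyper L (special_gamma lam) (special_nu lam) y z"
    by (rule res_gg_hyper_eq[OF yz])
  also have "\<dots> = delta_integral (tri L <+> tri L) (tri L) (tri_exponent L)
      (whittaker_delta L x) (whittaker_integrand L lam)"
    unfolding gg_hyper_def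
  proof (rule delta_integral_cong)
    fix T
    show "gg_integrand L (special_gamma lam) (special_nu lam) (exp_point (tri L <+> tri L) T)
        = whittaker_integrand L lam (exp_point (tri L <+> tri L) T)"
      by (rule whittaker_integrand_eq_gg_integrand[symmetric]) (simp add: exp_point_def InrI)
  qed (rule gg_delta_eq_whittaker_delta[OF yz])
  also have "\<dots> = exp (- complex_of_real (x (L + 1)) * (\<Sum>i=1..L+1. lam i)) * whittaker L lam x"
    by (simp add: whittaker_def exp_minus)
  finally show ?thesis .
qed

end
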